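(* Let $\mu$ be a law on $\mathbb{R}$ with finite second moment, centered and different from $\delta_0$, and let $\vartheta^2\in(0,\infty)$ be its variance. Say that $\mu$ is in $L^p$ if $\int|x|^p\,\mu(dx)<\infty$. (i) Let $p\in[3,\infty)$. If $\mu$ is in $L^p$, then, as $J\to\infty$, $$\frac{\vartheta^2}{2J}+O\left(\frac{(\log J)^{1/3}}{J^{4/3}}\right)\le F_\mu(J)\le\frac{\vartheta^2}{2J}+O\left(\frac{1}{J^{\frac{4p}{3p+2}}}\right).$$ (ii) Let $p\in[2,3)$. If $\mu$ is in $L^p$, then, as $J\to\infty$, $$\frac{\vartheta^2}{2J}+O\left(\frac{(\log J)^{\frac{p-1}{2p}}}{J^{\frac{2(p-1)}{p}}}\right)\le F_\mu(J)\le\frac{\vartheta^2}{2J}+O\left(\frac{1}{J^{\frac{2p(p-1)}{p^2+p-1}}}\right).$$ In particular, if $\mu$ is in $L^p$ for some $p>\frac{3+\sqrt5}{2}$, then the error terms are $o(1/J)$ and $F_\mu(J)\sim\frac{\vartheta^2}{2J}$ as $J\to\infty$.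
   Context: Let $\mathbb{N}=\{1,2,\dots\}$. For a law $\mu$ on $\mathbb{R}$ with finite first moment, let $h=(h_n)_{n\in\mathbb{N}}$ be, under $\mathbb{P}_\mu$, an i.i.d. sequence of real random variables with law $\mu$. For $N\in\mathbb{N}$, $(a,b)\in\{-1,+1\}^2$ and real $J$, the partition function of the Ising chain with external field $h$ is $$Z_{N,h}^{a,b}(J):=\sum_{\substack{\sigma\in\{-1,1\}^{\{0,1,\dots,N\}}\\ \sigma_0=a,\ \sigma_N=b}}\exp\Big(-2J\sum_{n=1}^N\mathbf 1_{\{\sigma_n\ne\sigma_{n-1}\}}+\sum_{n=1}^N\sigma_nh_n\Big).$$ The free energy density $F_\mu(J)$ is the deterministic real number such that, $\mathbb{P}_\mu$-almost surely, for every $(a,b)\in\{-1,+1\}^2$, $\frac1N\log Z_{N,h}^{a,b}(J)\to F_\mu(J)$ as $N\to\infty$ (this limit exists by Kingman's subadditive ergodic theorem). An inequality of the form $F(J)\ge f(J)+O(g(J))$ (resp. $\le$) as $J\to\infty$ means that there is a constant $C$ with $F(J)\ge f(J)-Cg(J)$ (resp. $F(J)\le f(J)+Cg(J)$) for all large $J$. *)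

theory Defs
  imports "HOL-Probability.Probability" "HOL-Library.Landau_Symbols"
begin

definition partition_fun :: "nat \<Rightarrow> (nat \<Rightarrow> real) \<Rightarrow> int \<Rightarrow> int \<Rightarrow> real \<Rightarrow> real" where
  "partition_fun N h a b J =
    (\<Sum>\<sigma> \<in> {\<sigma> \<in> {0..N} \<rightarrow>\<^sub>E {-1, 1 :: int}. \<sigma> 0 = a \<and> \<sigma> N = b}.
       exp (- 2 * J * (\<Sum>n=1..N. of_bool (\<sigma> n \<noteq> \<sigma> (n - 1)))
            + (\<Sum>n=1..N. of_int (\<sigma> n) * h n)))"

text \<open>The i.i.d. field is realised on its canonical space, the countable product of
  copies of \<open>\<mu>\<close> indexed by the positive integers.\<close>

definition field_measure :: "real measure \<Rightarrow> (nat \<Rightarrow> real) measure" where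
  "field_measure \<mu> = (\<Pi>\<^sub>M n\<in>{1..}. \<mu>)"

definition free_energy :: "real measure \<Rightarrow> real \<Rightarrow> real" where
  "free_energy \<mu> J =
    (THE F. AE h in field_measure \<mu>. \<forall>a\<in>{-1, 1}. \<forall>b\<in>{-1, 1}.
       (\<lambda>N. ln (partition_fun N h a b J) / real N) \<longlonglongrightarrow> F)"

definition in_Lp :: "real measure \<Rightarrow> real \<Rightarrow> bool" where
  "in_Lp \<mu> p \<longleftrightarrow> integrable \<mu> (\<lambda>x. \<bar>x\<bar> powr p)"

text \<open>One-sided error bounds: \<open>F J \<ge> f J + O(g J)\<close> and \<open>F J \<le> f J + O(g J)\<close> as \<open>J \<rightarrow> \<infinity>\<close>.\<close>

definition ge_upto_O :: "(real \<Rightarrow> real) \<Rightarrow> (real \<Rightarrow> real) \<Rightarrow> (real \<Rightarrow> real) \<Rightarrow> bool" where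
  "ge_upto_O F f g \<longleftrightarrow> (\<exists>C. \<forall>\<^sub>F J in at_top. F J \<ge> f J - C * g J)"

definition le_upto_O :: "(real \<Rightarrow> real) \<Rightarrow> (real \<Rightarrow> real) \<Rightarrow> (real \<Rightarrow> real) \<Rightarrow> bool" where
  "le_upto_O F f g \<longleftrightarrow> (\<exists>C. \<forall>\<^sub>F J in at_top. F J \<le> f J + C * g J)"

end

theory Submission
  imports Defs "HOL-Library.Discrete_Functions" "HOL-Real_Asymp.Real_Asymp"
begin

text \<open>
  Write the partition functions with final spin \<open>\<plusminus>1\<close> as \<open>exp (A\<^sub>n \<plusminus> l\<^sub>n)\<close>.  Then
  \<open>l\<^sub>n\<^sub>+\<^sub>1 = T l\<^sub>n + h\<^sub>n\<^sub>+\<^sub>1\<close> and \<open>A\<^sub>n\<^sub>+\<^sub>1 = A\<^sub>n + g l\<^sub>n\<close>, where \<open>T\<close> is a smooth version of the truncation to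
  \<open>[-J, J]\<close> and \<open>g l\<close> is close to \<open>max 0 (\<bar>l\<bar> - J)\<close>.  Since \<open>T\<close> is a strict contraction, the Poisson
  equation for \<open>g\<close> has a Lipschitz solution; this gives the law of large numbers for \<open>A\<^sub>n\<close>, and by a
  minimum principle it turns every pointwise drift inequality for a test function into a bound on
  the free energy.

  The identity \<open>2 J g l \<approx> l\<^sup>2 - (T l)\<^sup>2\<close> makes \<open>t\<^sup>2\<close> the test function that produces \<open>\<theta>\<^sup>2 / (2 J)\<close>.  The error
  in it is only felt when \<open>T l\<close> is within distance \<open>r\<close> of \<open>\<plusminus>J\<close> or when a single field value exceeds
  \<open>r\<close>; the time spent near \<open>\<plusminus>J\<close> is controlled by adding a multiple of a convex function whose second
  derivative is of order one there and whose slope is of order \<open>r\<close>.  The choice \<open>r = J powr (1 / q)\<close>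
  with \<open>q = min p 3\<close> gives a two-sided error \<open>J powr (- 2 (q - 1) / q)\<close>.
\<close>

section \<open>The one-step map\<close>

definition wall_cost :: "real \<Rightarrow> real \<Rightarrow> real" where
  "wall_cost J l = ln (1 + exp (2 * l - 2 * J)) / 2"

text \<open>If spins 1 and -1 have weights \<open>exp (A + l)\<close> and
  \<open>exp (A - l)\<close>, one transfer step without field turns the logarithms into
  \<open>A + l + 2 * wall_cost J (- l)\<close> and \<open>A - l + 2 * wall_cost J l\<close>.
  \<open>soft_clip\<close> is the new half-difference, \<open>gain\<close> the increase of the
  half-sum.\<close>

definition soft_clip :: "real \<Rightarrow> real \<Rightarrow> real" where
  "soft_clip J l = l - wall_cost J l + wall_cost J (- l)"

definition gain :: "real \<Rightarrow> real \<Rightarrow> real" where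
  "gain J l = wall_cost J l + wall_cost J (- l)"

lemma one_plus_exp_neq_0: "1 + exp x \<noteq> (0::real)"
  by (metis add_pos_pos exp_gt_zero less_irrefl zero_less_one)

lemma wall_cost_pos: "0 < wall_cost J l"
  by (simp add: wall_cost_def ln_gt_zero add_pos_pos)

lemma exp_wall_cost: "exp (2 * wall_cost J l) = 1 + exp (2 * l - 2 * J)"
  by (simp add: wall_cost_def add_pos_pos)

lemma wall_cost_le_exp: "wall_cost J l \<le> exp (2 * l - 2 * J) / 2"
  using ln_add_one_self_le_self[of "exp (2 * l - 2 * J)"] by (simp add: wall_cost_def)

lemma wall_cost_ge: "l - J \<le> wall_cost J l"
proof -
  have "2 * (l - J) = ln (exp (2 * l - 2 * J))" by simp
  also have "\<dots> \<le> ln (1 + exp (2 * l - 2 * J))"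
    by (subst ln_le_cancel_iff) (auto simp: add_pos_pos)
  finally show ?thesis by (simp add: wall_cost_def)
qed

lemma wall_cost_le:
  assumes "J \<le> l" shows "wall_cost J l \<le> l - J + 1/2"
proof -
  have "exp (2 * wall_cost J l) \<le> 2 * exp (2 * l - 2 * J)"
    using assms by (simp add: exp_wall_cost)
  also have "\<dots> \<le> exp 1 * exp (2 * l - 2 * J)"
    using exp_ge_add_one_self[of 1] by (intro mult_right_mono) auto
  also have "\<dots> = exp (2 * (l - J + 1/2))"
    by (simp add: algebra_simps flip: exp_add)
  finally show ?thesis by simp
qed

lemma gain_nonneg: "0 \<le> gain J l"
  using wall_cost_pos[of J l] wall_cost_pos[of J "-l"] by (simp add: gain_def)

lemma gain_minus: "gain J (- l) = gain J l"
  by (simp add: gain_def)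

lemma soft_clip_minus: "soft_clip J (- l) = - soft_clip J l"
  by (simp add: soft_clip_def)

lemma abs_soft_clip_diff_le: "\<bar>soft_clip J l - l\<bar> \<le> gain J l"
  using wall_cost_pos[of J l] wall_cost_pos[of J "-l"]
  by (simp add: gain_def soft_clip_def)

text \<open>Clearing the wall costs and exponentiating twice both sides reduces the claim to
  \<open>exp (- 2 * J) \<le> exp (2 * J)\<close>.\<close>

lemma soft_clip_le:
  assumes "0 \<le> J" shows "soft_clip J l \<le> J"
proof -
  have "exp (2 * l + 2 * wall_cost J (- l)) = exp (2 * l) + exp (- 2 * J)"
    unfolding exp_add exp_wall_cost by (simp add: distrib_left flip: exp_add)
  also have "\<dots> \<le> exp (2 * l) + exp (2 * J)"
    using assms by simp
  also have "\<dots> = exp (2 * J + 2 * wall_cost J l)"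
    unfolding exp_add exp_wall_cost by (simp add: distrib_left flip: exp_add)
  finally show ?thesis by (simp add: soft_clip_def)
qed

lemma abs_soft_clip_le: "0 \<le> J \<Longrightarrow> \<bar>soft_clip J l\<bar> \<le> J"
  using soft_clip_le[of J l] soft_clip_le[of J "- l"] by (simp add: soft_clip_minus)

lemma wall_cost_has_derivative:
  "((\<lambda>l. wall_cost J l) has_field_derivative
      exp (2 * l - 2 * J) / (1 + exp (2 * l - 2 * J))) (at l within A)"
  unfolding wall_cost_def
  by (auto intro!: derivative_eq_intros simp: add_pos_pos divide_simps)

lemma wall_cost_minus_has_derivative:
  "((\<lambda>l. wall_cost J (- l)) has_field_derivative
      - (exp (- 2 * l - 2 * J) / (1 + exp (- 2 * l - 2 * J)))) (at l within A)"
  unfolding wall_cost_def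
  by (auto intro!: derivative_eq_intros simp: add_pos_pos divide_simps)

text \<open>The derivative is a difference of two logistic values in [0, 1].\<close>

lemma gain_lipschitz: "\<bar>gain J k - gain J l\<bar> \<le> \<bar>k - l\<bar>"
proof -
  have "norm (gain J k - gain J l) \<le> 1 * norm (k - l)"
  proof (rule field_differentiable_bound[of UNIV])
    fix z :: real
    let ?a = "exp (2 * z - 2 * J)" and ?b = "exp (- 2 * z - 2 * J)"
    show "(gain J has_field_derivative ?a / (1 + ?a) - ?b / (1 + ?b)) (at z within UNIV)"
      unfolding gain_def[abs_def]
      using DERIV_add[OF wall_cost_has_derivative wall_cost_minus_has_derivative]
      by (simp add: algebra_simps)
    have "0 \<le> ?a / (1 + ?a)" "?a / (1 + ?a) \<le> 1" "0 \<le> ?b / (1 + ?b)" "?b / (1 + ?b) \<le> 1"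
      by (simp_all add: add_pos_pos)
    then show "norm (?a / (1 + ?a) - ?b / (1 + ?b)) \<le> 1"
      unfolding real_norm_def abs_le_iff by linarith
  qed auto
  then show ?thesis by simp
qed

text \<open>The rate degenerates exponentially in \<open>J\<close>, which is harmless: it only
  serves to solve the Poisson equation at fixed \<open>J\<close>.\<close>

lemma soft_clip_contraction:
  assumes "0 < J"
  shows "\<bar>soft_clip J k - soft_clip J l\<bar> \<le> (1 - exp (- 4 * J)) * \<bar>k - l\<bar>"
proof -
  have "norm (soft_clip J k - soft_clip J l) \<le> (1 - exp (- 4 * J)) * norm (k - l)"
  proof (rule field_differentiable_bound[of UNIV])
    fix z :: real
    let ?a = "exp (2 * z - 2 * J)" and ?b = "exp (- 2 * z - 2 * J)"
    show "(soft_clip J has_field_derivative 1 - ?a / (1 + ?a) - ?b / (1 + ?b)) (at z within UNIV)"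
      unfolding soft_clip_def[abs_def]
      using DERIV_add[OF DERIV_diff[OF DERIV_ident wall_cost_has_derivative] wall_cost_minus_has_derivative]
      by (simp add: algebra_simps)
    have ab: "?a * ?b = exp (- 4 * J)" by (simp flip: exp_add)
    have pos: "1 + ?a > 0" "1 + ?b > 0" by (simp_all add: add_pos_pos)
    \<comment> \<open>The product \<open>?a * ?b\<close> is free of \<open>z\<close>, so the
      contraction factor is uniform on the line.\<close>
    have eq: "1 - ?a / (1 + ?a) - ?b / (1 + ?b) = (1 - ?a * ?b) / ((1 + ?a) * (1 + ?b))"
      using pos by (simp add: divide_simps) (simp add: algebra_simps)
    have "0 \<le> 1 - ?a * ?b" unfolding ab using assms by simp
    moreover have "1 \<le> (1 + ?a) * (1 + ?b)"
      using mult_mono[of 1 "1 + ?a" 1 "1 + ?b"] by simp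
    ultimately have "0 \<le> (1 - ?a * ?b) / ((1 + ?a) * (1 + ?b))"
      "(1 - ?a * ?b) / ((1 + ?a) * (1 + ?b)) \<le> (1 - ?a * ?b) / 1"
      by (simp, intro divide_left_mono) auto
    then show "norm (1 - ?a / (1 + ?a) - ?b / (1 + ?b)) \<le> 1 - exp (- 4 * J)"
      unfolding eq ab by simp
  qed auto
  then show ?thesis by simp
qed

lemma continuous_on_gain [continuous_intros]:
  "continuous_on A f \<Longrightarrow> continuous_on A (\<lambda>x. gain J (f x))"
  unfolding gain_def wall_cost_def
  by (intro continuous_intros) (auto simp: one_plus_exp_neq_0)

lemma continuous_on_soft_clip [continuous_intros]:
  "continuous_on A f \<Longrightarrow> continuous_on A (\<lambda>x. soft_clip J (f x))"
  unfolding soft_clip_def wall_cost_def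
  by (intro continuous_intros) (auto simp: one_plus_exp_neq_0)

lemma gain_measurable [measurable]: "gain J \<in> borel_measurable borel"
  by (intro borel_measurable_continuous_onI continuous_intros)

lemma soft_clip_measurable [measurable]: "soft_clip J \<in> borel_measurable borel"
  by (intro borel_measurable_continuous_onI continuous_intros)

section \<open>Gain against the decrease of the square\<close>

lemma mult_exp_neg_le: "x * exp (- x) \<le> (1::real)"
proof -
  have "x \<le> exp x" using exp_ge_add_one_self[of x] by linarith
  then show ?thesis by (simp add: exp_minus field_simps)
qed

text \<open>By symmetry take \<open>l\<close> nonnegative. With \<open>u\<close>, \<open>v\<close>
  the two wall costs, the defect is exactly
  \<open>(u - v) * (2 * (J - l) + (u - v)) + 4 * J * v\<close>. Here \<open>v\<close> is
  exponentially small in \<open>J\<close>; the product is exponentially small in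
  \<open>J - l\<close> inside the wall and at most 2 beyond it.\<close>

lemma gain_upper:
  assumes "0 < J"
  shows "2 * J * gain J l \<le> l\<^sup>2 - (soft_clip J l)\<^sup>2 + 4 * exp (- max 0 (J - \<bar>l\<bar>))"
proof -
  have main: "2 * J * gain J l \<le> l\<^sup>2 - (soft_clip J l)\<^sup>2 + 4 * exp (- max 0 (J - l))"
    if "0 \<le> l" for l
  proof -
    define u where "u = wall_cost J l"
    define v where "v = wall_cost J (- l)"
    have uv: "0 < v" "v \<le> u"
      using wall_cost_pos \<open>0 \<le> l\<close> by (auto simp: u_def v_def wall_cost_def add_pos_pos)
    have "v \<le> exp (- 2 * J) / 2"
      using wall_cost_le_exp[of J "- l"] \<open>0 \<le> l\<close> by (simp add: v_def order_trans)
    \<comment> \<open>One factor \<open>exp (- J)\<close> absorbs the prefactor \<open>J\<close>;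
      the other is at most \<open>exp (- max 0 (J - l))\<close>.\<close>
    then have "4 * J * v \<le> 4 * J * (exp (- 2 * J) / 2)"
      using assms by (intro mult_left_mono) auto
    also have "\<dots> = 2 * (J * exp (- J)) * exp (- J)"
      by (simp flip: exp_add)
    also have "\<dots> \<le> 2 * 1 * exp (- max 0 (J - l))"
      using mult_exp_neg_le[of J] assms that by (intro mult_mono) auto
    finally have v4: "4 * J * v \<le> 2 * exp (- max 0 (J - l))" by simp
    have eq: "2 * J * gain J l - (l\<^sup>2 - (soft_clip J l)\<^sup>2)
        = (u - v) * (2 * (J - l) + (u - v)) + 4 * J * v"
      by (simp add: gain_def soft_clip_def flip: u_def v_def) (simp add: algebra_simps power2_eq_square)
    have "(u - v) * (2 * (J - l) + (u - v)) \<le> 2 * exp (- max 0 (J - l))"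
    proof (cases "l \<le> J")
      case True
      define d where "d = J - l"
      have d: "0 \<le> d" using True by (simp add: d_def)
      have u: "u \<le> exp (- 2 * d) / 2"
        using wall_cost_le_exp[of J l] by (simp add: u_def d_def algebra_simps)
      have "exp (- 2 * d) \<le> 1" using d by simp
      then have u1: "u \<le> 1" using u by linarith
      have "(u - v) * (2 * d + (u - v)) \<le> u * (2 * d + u)"
        using uv d by (intro mult_mono) auto
      also have "\<dots> \<le> exp (- 2 * d) / 2 * (2 * d + 1)"
        using u uv d u1 by (intro mult_mono) auto
      also have "\<dots> = exp (- d) * (d * exp (- d)) + exp (- d) * (exp (- d) / 2)"
        by (simp add: algebra_simps flip: exp_add)
      also have "\<dots> \<le> exp (- d) * 1 + exp (- d) * 1"
        using mult_exp_neg_le[of d] d by (intro add_mono mult_left_mono) (auto simp: order_trans[of _ 1])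
      finally show ?thesis using d by (simp add: d_def)
    next
      case False
      define y where "y = l - J"
      have y: "0 < y" "y \<le> u" "u \<le> y + 1/2"
        using False wall_cost_ge[of l J] wall_cost_le[of J l] by (auto simp: y_def u_def)
      have "(u - v) * (2 * (J - l) + (u - v)) \<le> 2"
      \<comment> \<open>As \<open>u \<le> y + 1/2\<close>, the second factor is at most
        \<open>1/2 - y\<close>: a small overshoot gives a small product, a larger one a nonpositive
        product.\<close>
      proof (cases "y \<le> 1/2")
        case True
        then have "(u - v) * (2 * (J - l) + (u - v)) \<le> (u - v) * 1"
          using y uv by (intro mult_left_mono) (auto simp: y_def)
        moreover have "(u - v) * 1 \<le> 2" using True y uv by simp
        ultimately show ?thesis by (rule order_trans)
      next
        case False
        then show ?thesis
          using y uv mult_nonneg_nonpos[of "u - v" "2 * (J - l) + (u - v)"] by (auto simp: y_def)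
      qed
      then show ?thesis using False by simp
    qed
    then show ?thesis using eq v4 by linarith
  qed
  show ?thesis
    using main[of l] main[of "- l"] by (cases "0 \<le> l") (auto simp: gain_minus soft_clip_minus)
qed

text \<open>The defect is the same expression as in \<open>gain_upper\<close>. Inside the wall it is
  nonnegative. Beyond it, \<open>u - v\<close> is within 1/2 of the overshoot \<open>y\<close>, so
  the product is at least -(y + 1/2)^2, and (y + 1/2)^2 is at most 2 y^2 + 1.\<close>

lemma gain_lower:
  assumes "0 < J"
  shows "2 * J * gain J l \<ge> l\<^sup>2 - (soft_clip J l)\<^sup>2
    - (if \<bar>l\<bar> \<le> J then 0 else 2 * (\<bar>l\<bar> - J)\<^sup>2 + 1)"
proof -
  have main: "2 * J * gain J l \<ge> l\<^sup>2 - (soft_clip J l)\<^sup>2 - (if l \<le> J then 0 else 2 * (l - J)\<^sup>2 + 1)"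
    if "0 \<le> l" for l
  proof -
    define u where "u = wall_cost J l"
    define v where "v = wall_cost J (- l)"
    have uv: "0 < v" "v \<le> u"
      using wall_cost_pos \<open>0 \<le> l\<close> by (auto simp: u_def v_def wall_cost_def add_pos_pos)
    have eq: "2 * J * gain J l - (l\<^sup>2 - (soft_clip J l)\<^sup>2)
        = (u - v) * (2 * (J - l) + (u - v)) + 4 * J * v"
      by (simp add: gain_def soft_clip_def flip: u_def v_def) (simp add: algebra_simps power2_eq_square)
    have "(u - v) * (2 * (J - l) + (u - v)) \<ge> - (if l \<le> J then 0 else 2 * (l - J)\<^sup>2 + 1)"
    proof (cases "l \<le> J")
      case True
      then show ?thesis using uv by simp
    next
      case False
      define y where "y = l - J"
      have y: "0 < y" "y \<le> u" "u \<le> y + 1/2"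
        using False wall_cost_ge[of l J] wall_cost_le[of J l] by (auto simp: y_def u_def)
      have v: "v \<le> 1/2"
      proof -
        have "exp (2 * (- l) - 2 * J) \<le> 1" using \<open>0 \<le> l\<close> assms by simp
        then show ?thesis using wall_cost_le_exp[of J "- l"] unfolding v_def by linarith
      qed
      have "(u - v) * (2 * y - (u - v)) \<le> (y + 1/2) * (y + 1/2)"
        using y uv v by (cases "0 \<le> 2 * y - (u - v)") (intro mult_mono, auto intro: order_trans[OF mult_nonneg_nonpos])
      also have "\<dots> \<le> 2 * y\<^sup>2 + 1"
        using zero_le_power2[of "y - 1/2"] by (simp add: power2_eq_square algebra_simps)
      finally show ?thesis using False by (simp add: y_def algebra_simps)
    qed
    moreover have "0 \<le> 4 * J * v" using assms uv by simp
    ultimately show ?thesis using eq by linarith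
  qed
  show ?thesis
    using main[of l] main[of "- l"] by (cases "0 \<le> l") (auto simp: gain_minus soft_clip_minus)
qed

section \<open>The Poisson equation\<close>

lemma lipschitz_continuous:
  fixes u :: "real \<Rightarrow> real"
  assumes "\<And>x y. \<bar>u x - u y\<bar> \<le> L * \<bar>x - y\<bar>"
  shows "continuous_on UNIV u"
proof -
  have "0 \<le> L" using assms[of 1 0] by (simp add: order_trans[OF abs_ge_zero])
  then have "L-lipschitz_on UNIV u"
    using assms by (intro lipschitz_onI) (auto simp: dist_real_def)
  then show ?thesis by (rule lipschitz_on_continuous_on)
qed

locale ising_chain = prob_space \<mu> for \<mu> :: "real measure" +
  fixes J :: real
  assumes sets_mu [measurable_cong, simp]: "sets \<mu> = sets borel"
    and square_integrable: "integrable \<mu> (\<lambda>x. x\<^sup>2)"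
    and J_pos: "0 < J"
begin

lemma integrable_id: "integrable \<mu> (\<lambda>x. x)"
  by (rule square_integrable_imp_integrable[OF _ square_integrable]) simp

lemma integrable_linear_growth:
  assumes [measurable]: "f \<in> borel_measurable borel" and "\<And>x. \<bar>f x\<bar> \<le> A + B * \<bar>x\<bar>"
  shows "integrable \<mu> f"
proof (rule Bochner_Integration.integrable_bound)
  show "integrable \<mu> (\<lambda>x. A + B * \<bar>x\<bar>)"
    using integrable_id by (intro Bochner_Integration.integrable_add integrable_mult_right integrable_abs) auto
  show "AE x in \<mu>. norm (f x) \<le> norm (A + B * \<bar>x\<bar>)"
    using assms(2) by (intro AE_I2) (auto intro: order_trans[OF _ abs_ge_self])
qed simp

lemma integrable_gain: "integrable \<mu> (\<lambda>x. gain J (t + x))"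
proof (rule integrable_linear_growth)
  fix x
  show "\<bar>gain J (t + x)\<bar> \<le> (gain J 0 + \<bar>t\<bar>) + 1 * \<bar>x\<bar>"
    using gain_lipschitz[of J "t + x" 0] gain_nonneg[of J "t + x"] by simp
qed simp

lemma clip_in_range: "soft_clip J l \<in> {- J .. J}"
  using abs_soft_clip_le[of J l] J_pos by (auto simp: abs_le_iff)

text \<open>The clip confines the argument to [-J, J], where a continuous test function is
  bounded.\<close>

lemma integrable_clip:
  fixes W :: "real \<Rightarrow> real"
  assumes "continuous_on UNIV W"
  shows "integrable \<mu> (\<lambda>x. W (soft_clip J (t + x)))"
proof -
  have [measurable]: "W \<in> borel_measurable borel"
    using assms by (rule borel_measurable_continuous_onI)
  have "compact (W ` {- J .. J})"
    using assms by (intro compact_continuous_image) (auto intro: continuous_on_subset)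
  then have "bounded (W ` {- J .. J})" by (rule compact_imp_bounded)
  then obtain B where B: "\<And>y. y \<in> {- J .. J} \<Longrightarrow> \<bar>W y\<bar> \<le> B"
    unfolding bounded_iff real_norm_def by blast
  show ?thesis
    by (rule integrable_const_bound[where B=B]) (use B[OF clip_in_range] in auto)
qed

definition bellman :: "(real \<Rightarrow> real) \<Rightarrow> real \<Rightarrow> real" where
  "bellman u t = (\<integral>x. gain J (t + x) + u (soft_clip J (t + x)) \<partial>\<mu>)"

text \<open>Value iteration for \<open>bellman U t = F + U t\<close>, renormalised at 0 so that the
  constant \<open>F\<close> does not accumulate.\<close>

primrec iter :: "nat \<Rightarrow> real \<Rightarrow> real" where
  "iter 0 = (\<lambda>t. 0)"
| "iter (Suc k) = (\<lambda>t. bellman (iter k) t - bellman (iter k) 0)"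

text \<open>The gain cancels in the difference, so the contraction of \<open>soft_clip\<close>
  shrinks the Lipschitz seminorm.\<close>

lemma bellman_diff_lipschitz:
  assumes u: "continuous_on UNIV u" and w: "continuous_on UNIV w"
    and c: "\<And>x y. \<bar>(u x - w x) - (u y - w y)\<bar> \<le> c * \<bar>x - y\<bar>" and "0 \<le> c"
  shows "\<bar>(bellman u s - bellman w s) - (bellman u t - bellman w t)\<bar>
    \<le> c * (1 - exp (- 4 * J)) * \<bar>s - t\<bar>"
proof -
  note int = integrable_gain integrable_clip[OF u] integrable_clip[OF w]
  have eq: "(bellman u s - bellman w s) - (bellman u t - bellman w t)
    = (\<integral>x. (u (soft_clip J (s + x)) - w (soft_clip J (s + x)))
          - (u (soft_clip J (t + x)) - w (soft_clip J (t + x))) \<partial>\<mu>)"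
    unfolding bellman_def using int by simp
  have "\<bar>\<dots>\<bar> \<le> (\<integral>x. \<bar>(u (soft_clip J (s + x)) - w (soft_clip J (s + x)))
          - (u (soft_clip J (t + x)) - w (soft_clip J (t + x)))\<bar> \<partial>\<mu>)"
    by (rule integral_abs_bound)
  also have "\<dots> \<le> (\<integral>x. c * (1 - exp (- 4 * J)) * \<bar>s - t\<bar> \<partial>\<mu>)"
  proof (rule integral_mono)
    fix x
    have "\<bar>soft_clip J (s + x) - soft_clip J (t + x)\<bar> \<le> (1 - exp (- 4 * J)) * \<bar>s - t\<bar>"
      using soft_clip_contraction[OF J_pos, of "s + x" "t + x"] by simp
    from mult_left_mono[OF this \<open>0 \<le> c\<close>]
    show "\<bar>(u (soft_clip J (s + x)) - w (soft_clip J (s + x)))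
          - (u (soft_clip J (t + x)) - w (soft_clip J (t + x)))\<bar> \<le> c * (1 - exp (- 4 * J)) * \<bar>s - t\<bar>"
      using c[of "soft_clip J (s + x)" "soft_clip J (t + x)"] by (simp add: mult.assoc)
  qed (use int in auto)
  also have "\<dots> = c * (1 - exp (- 4 * J)) * \<bar>s - t\<bar>"
    by (simp add: prob_space)
  finally show ?thesis unfolding eq .
qed

lemma bellman_zero_lipschitz: "\<bar>bellman (\<lambda>t. 0) s - bellman (\<lambda>t. 0) t\<bar> \<le> \<bar>s - t\<bar>"
proof -
  have "bellman (\<lambda>t. 0) s - bellman (\<lambda>t. 0) t = (\<integral>x. gain J (s + x) - gain J (t + x) \<partial>\<mu>)"
    unfolding bellman_def using integrable_gain by simp
  also have "\<bar>\<dots>\<bar> \<le> (\<integral>x. \<bar>gain J (s + x) - gain J (t + x)\<bar> \<partial>\<mu>)"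
    by (rule integral_abs_bound)
  also have "\<dots> \<le> (\<integral>x. \<bar>s - t\<bar> \<partial>\<mu>)"
  proof (rule integral_mono)
    show "\<bar>gain J (s + x) - gain J (t + x)\<bar> \<le> \<bar>s - t\<bar>" for x
      using gain_lipschitz[of J "s + x" "t + x"] by simp
  qed (use integrable_gain in auto)
  also have "\<dots> = \<bar>s - t\<bar>" by (simp add: prob_space)
  finally show ?thesis .
qed

text \<open>\<open>exp (4 * J)\<close> is the fixed point of \<open>c\<close> ->
  \<open>1 + c * (1 - exp (- 4 * J))\<close>, the recursion for the Lipschitz constants.\<close>

lemma iter_lipschitz: "\<bar>iter k s - iter k t\<bar> \<le> exp (4 * J) * \<bar>s - t\<bar>"
proof (induction k arbitrary: s t)
  case (Suc k)
  have "\<bar>(bellman (iter k) s - bellman (\<lambda>t. 0) s) - (bellman (iter k) t - bellman (\<lambda>t. 0) t)\<bar>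
      \<le> exp (4 * J) * (1 - exp (- 4 * J)) * \<bar>s - t\<bar>"
    using Suc.IH by (intro bellman_diff_lipschitz lipschitz_continuous[OF Suc.IH]) auto
  also have "exp (4 * J) * (1 - exp (- 4 * J)) = exp (4 * J) - 1"
    by (simp add: algebra_simps flip: exp_add)
  finally show ?case using bellman_zero_lipschitz[of s t] by (simp add: algebra_simps)
qed auto

lemma iter_step_lipschitz:
  "\<bar>(iter (Suc k) s - iter k s) - (iter (Suc k) t - iter k t)\<bar> \<le> (1 - exp (- 4 * J)) ^ k * \<bar>s - t\<bar>"
proof (induction k arbitrary: s t)
  case 0
  then show ?case using bellman_zero_lipschitz[of s t] by simp
next
  case (Suc k)
  have "\<bar>(bellman (iter (Suc k)) s - bellman (iter k) s) - (bellman (iter (Suc k)) t - bellman (iter k) t)\<bar>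
      \<le> (1 - exp (- 4 * J)) ^ k * (1 - exp (- 4 * J)) * \<bar>s - t\<bar>"
    using Suc.IH J_pos
    by (intro bellman_diff_lipschitz lipschitz_continuous[OF iter_lipschitz]) auto
  then show ?case by (simp add: algebra_simps)
qed

lemma iter_0: "iter k 0 = 0"
  by (induction k) auto

text \<open>All iterates vanish at 0, so the decaying Lipschitz constants of the increments bound
  them pointwise by a geometric series.\<close>

lemma iter_convergent: "convergent (\<lambda>k. iter k t)"
proof -
  have "summable (\<lambda>k. iter (Suc k) t - iter k t)"
  proof (rule summable_comparison_test')
    show "summable (\<lambda>k. (1 - exp (- 4 * J)) ^ k * \<bar>t\<bar>)"
      using J_pos by (intro summable_mult2 summable_geometric) auto
    show "norm (iter (Suc k) t - iter k t) \<le> (1 - exp (- 4 * J)) ^ k * \<bar>t\<bar>" for k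
      using iter_step_lipschitz[of k t 0] by (simp del: iter.simps add: iter_0)
  qed
  moreover have "(\<Sum>k<n. iter (Suc k) t - iter k t) = iter n t" for n
    using sum_lessThan_telescope[of "\<lambda>k. iter k t" n] by (simp del: iter.simps(2))
  ultimately show ?thesis
    unfolding summable_iff_convergent by (simp del: iter.simps)
qed

text \<open>The limit of the iterates solves the equation with \<open>F = bellman U 0\<close> and
  inherits their Lipschitz bound.\<close>

lemma poisson_equation:
  obtains U F where "\<And>s t. \<bar>U s - U t\<bar> \<le> exp (4 * J) * \<bar>s - t\<bar>"
    and "\<And>t. bellman U t = F + U t"
proof -
  define U where "U t = lim (\<lambda>k. iter k t)" for t
  have lim: "(\<lambda>k. iter k t) \<longlonglongrightarrow> U t" for t
    using iter_convergent by (simp add: U_def convergent_LIMSEQ_iff)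
  have lip: "\<bar>U s - U t\<bar> \<le> exp (4 * J) * \<bar>s - t\<bar>" for s t
    by (rule LIMSEQ_le_const2[OF tendsto_rabs[OF tendsto_diff[OF lim lim]]]) (use iter_lipschitz in auto)
  note cont = lipschitz_continuous[OF lip] lipschitz_continuous[OF iter_lipschitz]
  have [measurable]: "U \<in> borel_measurable borel" "iter k \<in> borel_measurable borel" for k
    using cont by (auto intro: borel_measurable_continuous_onI)
  have blim: "(\<lambda>k. bellman (iter k) t) \<longlonglongrightarrow> bellman U t" for t
    unfolding bellman_def
  \<comment> \<open>The iterates vanish at 0 and the clip stays in [-J, J], so the uniform Lipschitz
    bound yields an integrable majorant.\<close>
  proof (rule integral_dominated_convergence[where w="\<lambda>x. gain J (t + x) + exp (4 * J) * J"])
    show "integrable \<mu> (\<lambda>x. gain J (t + x) + exp (4 * J) * J)"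
      using integrable_gain by simp
    show "AE x in \<mu>. (\<lambda>k. gain J (t + x) + iter k (soft_clip J (t + x)))
        \<longlonglongrightarrow> gain J (t + x) + U (soft_clip J (t + x))"
      by (intro AE_I2 tendsto_intros lim)
    show "AE x in \<mu>. norm (gain J (t + x) + iter k (soft_clip J (t + x))) \<le> gain J (t + x) + exp (4 * J) * J" for k
    proof (intro AE_I2)
      fix x
      have "\<bar>iter k (soft_clip J (t + x))\<bar> \<le> exp (4 * J) * \<bar>soft_clip J (t + x)\<bar>"
        using iter_lipschitz[of k "soft_clip J (t + x)" 0] by (simp add: iter_0)
      also have "\<dots> \<le> exp (4 * J) * J"
        using abs_soft_clip_le J_pos by (intro mult_left_mono) auto
      finally show "norm (gain J (t + x) + iter k (soft_clip J (t + x))) \<le> gain J (t + x) + exp (4 * J) * J"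
        using gain_nonneg[of J "t + x"] by auto
    qed
  qed auto
  have "bellman U t = bellman U 0 + U t" for t
  proof -
    have "(\<lambda>k. iter (Suc k) t) \<longlonglongrightarrow> bellman U t - bellman U 0"
      unfolding iter.simps by (intro tendsto_diff blim)
    then have "U t = bellman U t - bellman U 0"
      using LIMSEQ_unique[OF LIMSEQ_Suc[OF lim]] by blast
    then show ?thesis by simp
  qed
  with lip show ?thesis by (rule that)
qed

text \<open>Evaluate the drift inequality at a minimum of \<open>W - a U\<close>.\<close>

lemma comparison_le:
  assumes U: "continuous_on UNIV U" "\<And>t. bellman U t = F + U t"
    and W: "continuous_on UNIV W"
    and le: "\<And>t. t \<in> {- J .. J} \<Longrightarrow>
      a * (\<integral>x. gain J (t + x) \<partial>\<mu>) + (\<integral>x. W (soft_clip J (t + x)) \<partial>\<mu>) \<le> c + W t"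
  shows "a * F \<le> c"
proof -
  let ?D = "\<lambda>t. W t - a * U t"
  have D: "continuous_on UNIV ?D" by (intro continuous_intros U W)
  have "\<exists>t\<in>{- J .. J}. \<forall>s\<in>{- J .. J}. ?D t \<le> ?D s"
    using J_pos by (intro continuous_attains_inf continuous_on_subset[OF D]) auto
  then obtain t where t: "t \<in> {- J .. J}" "\<And>s. s \<in> {- J .. J} \<Longrightarrow> ?D t \<le> ?D s"
    by blast
  note int = integrable_gain integrable_clip[OF U(1)] integrable_clip[OF W]
  have "?D t = (\<integral>x. ?D t \<partial>\<mu>)" by (simp add: prob_space)
  also have "\<dots> \<le> (\<integral>x. ?D (soft_clip J (t + x)) \<partial>\<mu>)"
    using int t(2)[OF clip_in_range] by (intro integral_mono) auto
  also have "\<dots> = (\<integral>x. W (soft_clip J (t + x)) \<partial>\<mu>) - a * (\<integral>x. U (soft_clip J (t + x)) \<partial>\<mu>)"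
    using int by simp
  also have "(\<integral>x. U (soft_clip J (t + x)) \<partial>\<mu>) = F + U t - (\<integral>x. gain J (t + x) \<partial>\<mu>)"
    using U(2)[of t] int by (simp add: bellman_def)
  finally show ?thesis using le[OF t(1)] by (simp add: algebra_simps)
qed

text \<open>\<open>comparison_le\<close> leaves the sign of \<open>a\<close> free, so it applies to
  \<open>- W\<close> and \<open>- a\<close>.\<close>

lemma comparison_ge:
  assumes U: "continuous_on UNIV U" "\<And>t. bellman U t = F + U t"
    and W: "continuous_on UNIV W"
    and ge: "\<And>t. t \<in> {- J .. J} \<Longrightarrow>
      a * (\<integral>x. gain J (t + x) \<partial>\<mu>) + (\<integral>x. W (soft_clip J (t + x)) \<partial>\<mu>) \<ge> c + W t"
  shows "a * F \<ge> c"
  using comparison_le[OF U, where W="\<lambda>t. - W t" and a="- a" and c="- c"] ge W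
  by (force intro: continuous_intros)

end

section \<open>Identification of the free energy\<close>

text \<open>The series of the squares has finite expectation, hence converges almost surely, and its
  terms tend to 0.\<close>

lemma AE_tendsto_zero_of_summable_second_moment:
  fixes X :: "nat \<Rightarrow> 'a \<Rightarrow> real"
  assumes int: "\<And>k. integrable M (\<lambda>x. (X k x)\<^sup>2)" and b: "summable b"
    and le: "\<And>k. (\<integral>x. (X k x)\<^sup>2 \<partial>M) \<le> b k"
  shows "AE x in M. (\<lambda>k. X k x) \<longlonglongrightarrow> 0"
proof -
  have [measurable]: "\<And>k. (\<lambda>x. (X k x)\<^sup>2) \<in> borel_measurable M"
    using int by auto
  have b0: "0 \<le> b k" for k
    using le[of k] by (meson Bochner_Integration.integral_nonneg order_trans zero_le_power2)
  have "(\<integral>\<^sup>+x. (\<Sum>k. ennreal ((X k x)\<^sup>2)) \<partial>M) = (\<Sum>k. \<integral>\<^sup>+x. ennreal ((X k x)\<^sup>2) \<partial>M)"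
    by (rule nn_integral_suminf) simp
  also have "\<dots> = (\<Sum>k. ennreal (\<integral>x. (X k x)\<^sup>2 \<partial>M))"
    using int by (simp add: nn_integral_eq_integral)
  also have "\<dots> \<le> (\<Sum>k. ennreal (b k))"
    using le by (intro suminf_le) (auto intro: ennreal_leI)
  also have "\<dots> = ennreal (\<Sum>k. b k)"
    using b b0 by (rule suminf_ennreal2[OF _ _, rotated])
  also have "\<dots> < top" by simp
  finally have "AE x in M. (\<Sum>k. ennreal ((X k x)\<^sup>2)) \<noteq> \<infinity>"
    by (intro nn_integral_PInf_AE) auto
  then show ?thesis
  proof eventually_elim
    case (elim x)
    then have "summable (\<lambda>k. (X k x)\<^sup>2)"
      by (intro summable_suminf_not_top) auto
    then have "(\<lambda>k. sqrt ((X k x)\<^sup>2)) \<longlonglongrightarrow> sqrt 0"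
      by (intro tendsto_real_sqrt summable_LIMSEQ_zero)
    then show ?case by (simp add: tendsto_rabs_zero_iff)
  qed
qed

text \<open>Monotone interpolation between consecutive squares, whose ratio tends to 1.\<close>

lemma LIMSEQ_average_from_squares:
  fixes A :: "nat \<Rightarrow> real"
  assumes mono: "incseq A" and nonneg: "\<And>n. 0 \<le> A n"
    and lim: "(\<lambda>k. A (k\<^sup>2) / (real k)\<^sup>2) \<longlonglongrightarrow> F"
  shows "(\<lambda>n. A n / real n) \<longlonglongrightarrow> F"
proof (rule tendsto_sandwich)
  have s: "filterlim floor_sqrt at_top at_top"
    unfolding filterlim_at_top
    by (metis eventually_at_top_linorder le_floor_sqrtI)
  have 1: "(\<lambda>k::nat. (real k / real (Suc k))\<^sup>2) \<longlonglongrightarrow> 1"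
    using tendsto_power[OF LIMSEQ_n_over_Suc_n, of 2] by simp
  have 2: "(\<lambda>k::nat. (real (Suc k) / real k)\<^sup>2) \<longlonglongrightarrow> 1"
    using tendsto_power[OF LIMSEQ_Suc_n_over_n, of 2] by simp
  have "(\<lambda>k. A (k\<^sup>2) / (real k)\<^sup>2 * (real k / real (Suc k))\<^sup>2) \<longlonglongrightarrow> F * 1"
    by (intro tendsto_mult lim 1)
  then show "(\<lambda>n. A ((floor_sqrt n)\<^sup>2) / (real (floor_sqrt n))\<^sup>2
      * (real (floor_sqrt n) / real (Suc (floor_sqrt n)))\<^sup>2) \<longlonglongrightarrow> F"
    using filterlim_compose[OF _ s] by fastforce
  have "(\<lambda>k. A ((Suc k)\<^sup>2) / (real (Suc k))\<^sup>2 * (real (Suc k) / real k)\<^sup>2) \<longlonglongrightarrow> F * 1"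
    by (intro tendsto_mult LIMSEQ_Suc[OF lim] 2)
  then show "(\<lambda>n. A ((Suc (floor_sqrt n))\<^sup>2) / (real (Suc (floor_sqrt n)))\<^sup>2
      * (real (Suc (floor_sqrt n)) / real (floor_sqrt n))\<^sup>2) \<longlonglongrightarrow> F"
    using filterlim_compose[OF _ s] by fastforce
  show "\<forall>\<^sub>F n in sequentially. A ((floor_sqrt n)\<^sup>2) / (real (floor_sqrt n))\<^sup>2
      * (real (floor_sqrt n) / real (Suc (floor_sqrt n)))\<^sup>2 \<le> A n / real n"
    using eventually_gt_at_top[of 0]
  proof eventually_elim
    case (elim n)
    define k where "k = floor_sqrt n"
    have k: "0 < k" "k\<^sup>2 \<le> n" "n \<le> (Suc k)\<^sup>2"
      using elim Suc_floor_sqrt_power2_gt[of n] by (auto simp: k_def)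
    have "A (k\<^sup>2) / (real k)\<^sup>2 * (real k / real (Suc k))\<^sup>2 = A (k\<^sup>2) / real ((Suc k)\<^sup>2)"
      using k by (simp add: power_divide)
    also have "\<dots> \<le> A n / real n"
      using k elim nonneg incseqD[OF mono k(2)] by (intro frac_le) (auto simp flip: of_nat_power)
    finally show ?case by (simp add: k_def)
  qed
  show "\<forall>\<^sub>F n in sequentially. A n / real n \<le> A ((Suc (floor_sqrt n))\<^sup>2) / (real (Suc (floor_sqrt n)))\<^sup>2
      * (real (Suc (floor_sqrt n)) / real (floor_sqrt n))\<^sup>2"
    using eventually_gt_at_top[of 0]
  proof eventually_elim
    case (elim n)
    define k where "k = floor_sqrt n"
    have k: "0 < k" "k\<^sup>2 \<le> n" "n \<le> (Suc k)\<^sup>2"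
      using elim Suc_floor_sqrt_power2_gt[of n] by (auto simp: k_def)
    have "A n / real n \<le> A ((Suc k)\<^sup>2) / real (k\<^sup>2)"
      using k elim nonneg incseqD[OF mono k(3)] by (intro frac_le) (auto simp flip: of_nat_power)
    also have "\<dots> = A ((Suc k)\<^sup>2) / (real (Suc k))\<^sup>2 * (real (Suc k) / real k)\<^sup>2"
      by (simp add: power_divide del: of_nat_Suc)
    finally show ?case by (simp add: k_def)
  qed
qed

section \<open>Transfer recursion for the partition functions\<close>

primrec chain :: "real \<Rightarrow> real \<Rightarrow> (nat \<Rightarrow> real) \<Rightarrow> nat \<Rightarrow> real" where
  "chain J t h 0 = t"
| "chain J t h (Suc n) = soft_clip J (chain J t h n + h (Suc n))"

lemma partition_fun_0:
  "a \<in> {-1, 1} \<Longrightarrow> partition_fun 0 h a b J = (if a = b then 1 else 0)"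
proof -
  assume a: "a \<in> {-1, 1}"
  have "{\<sigma> \<in> {0..0::nat} \<rightarrow>\<^sub>E {-1, 1 :: int}. \<sigma> 0 = a \<and> \<sigma> 0 = b} = (if a = b then {\<lambda>i\<in>{0}. a} else {})"
    using a by (auto simp: PiE_iff extensional_def fun_eq_iff)
  then show ?thesis by (simp add: partition_fun_def)
qed

text \<open>Transfer-matrix step: delete the last spin, then sort the shorter configurations by
  their own last spin \<open>c\<close>.\<close>

lemma partition_fun_Suc:
  assumes b: "b \<in> {-1, 1}"
  shows "partition_fun (Suc N) h a b J =
    (\<Sum>c\<in>{-1, 1}. partition_fun N h a c J * exp (- 2 * J * of_bool (b \<noteq> c) + of_int b * h (Suc N)))"
proof -
  let ?S = "{\<sigma> \<in> {0..N} \<rightarrow>\<^sub>E {-1, 1 :: int}. \<sigma> 0 = a}"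
  let ?w = "\<lambda>N \<sigma>. exp (- 2 * J * (\<Sum>n=1..N. of_bool (\<sigma> n \<noteq> \<sigma> (n - 1))) + (\<Sum>n=1..N. of_int (\<sigma> n) * h n))"
  let ?e = "\<lambda>c. exp (- 2 * J * of_bool (b \<noteq> c) + of_int b * h (Suc N))"
  have fin: "finite ?S" by (auto intro!: finite_subset[OF _ finite_PiE[of "{0..N}" "\<lambda>_. {-1, 1}"]])
  have "partition_fun (Suc N) h a b J = (\<Sum>\<sigma>\<in>?S. ?w N \<sigma> * ?e (\<sigma> N))"
    unfolding partition_fun_def
  proof (rule sum.reindex_bij_witness[where i="\<lambda>\<sigma>. \<sigma>(Suc N := b)" and j="\<lambda>\<sigma>. restrict \<sigma> {0..N}"])
    fix \<sigma> assume s: "\<sigma> \<in> {\<sigma> \<in> {0..Suc N} \<rightarrow>\<^sub>E {- 1, 1}. \<sigma> 0 = a \<and> \<sigma> (Suc N) = b}"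
    show "(restrict \<sigma> {0..N})(Suc N := b) = \<sigma>"
      using s by (auto simp: fun_eq_iff restrict_def PiE_iff extensional_def le_Suc_eq)
    show "restrict \<sigma> {0..N} \<in> ?S"
      using s by (auto simp: PiE_iff)
    have 1: "(\<Sum>n=1..N. of_bool ((restrict \<sigma> {0..N}) n \<noteq> (restrict \<sigma> {0..N}) (n - 1)) :: real)
        = (\<Sum>n=1..N. of_bool (\<sigma> n \<noteq> \<sigma> (n - 1)))"
      by (intro sum.cong) auto
    have 2: "(\<Sum>n=1..N. of_int ((restrict \<sigma> {0..N}) n) * h n) = (\<Sum>n=1..N. of_int (\<sigma> n) * h n)"
      by (intro sum.cong) auto
    show "?w N (restrict \<sigma> {0..N}) * ?e (restrict \<sigma> {0..N} N) = ?w (Suc N) \<sigma>"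
      unfolding 1 2 using s by (auto simp: algebra_simps simp flip: exp_add)
  next
    fix \<sigma> assume s: "\<sigma> \<in> ?S"
    show "restrict (\<sigma>(Suc N := b)) {0..N} = \<sigma>"
      using s by (auto simp: fun_eq_iff restrict_def PiE_iff extensional_def)
    show "\<sigma>(Suc N := b) \<in> {\<sigma> \<in> {0..Suc N} \<rightarrow>\<^sub>E {- 1, 1}. \<sigma> 0 = a \<and> \<sigma> (Suc N) = b}"
      using s b by (auto simp: PiE_iff extensional_def le_Suc_eq)
  qed
  also have "\<dots> = (\<Sum>c\<in>{-1, 1}. \<Sum>\<sigma>\<in>{\<sigma> \<in> ?S. \<sigma> N = c}. ?w N \<sigma> * ?e (\<sigma> N))"
    using fin by (intro sum.group[symmetric]) (auto simp: PiE_iff)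
  also have "\<dots> = (\<Sum>c\<in>{-1, 1}. partition_fun N h a c J * ?e c)"
    unfolding partition_fun_def sum_distrib_right
    by (intro sum.cong refl) auto
  finally show ?thesis .
qed

text \<open>The fixed left spin enters as the starting value \<open>of_int a * J\<close>, because
  the first bond contributes \<open>- 2 * J * of_bool (b \<noteq> a)\<close> =
  \<open>- J + of_int (a * b) * J\<close>. Each later bond adds one gain and moves the chain by one
  step.\<close>

lemma partition_fun_eq:
  assumes a: "a \<in> {-1, 1}" and b: "b \<in> {-1, 1}"
  shows "partition_fun (Suc n) h a b J = exp (- J
    + (\<Sum>i<n. gain J (chain J (of_int a * J) h i + h (Suc i)))
    + of_int b * (chain J (of_int a * J) h n + h (Suc n)))"
  using b
proof (induction n arbitrary: b)
  case 0
  then show ?case using a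
    by (auto simp: partition_fun_Suc partition_fun_0 algebra_simps)
next
  case (Suc n)
  define A where "A = - J + (\<Sum>i<n. gain J (chain J (of_int a * J) h i + h (Suc i)))"
  define l where "l = chain J (of_int a * J) h n + h (Suc n)"
  define x where "x = h (Suc (Suc n))"
  have IH: "partition_fun (Suc n) h a c J = exp (A + of_int c * l)" if "c \<in> {-1, 1}" for c
    unfolding A_def l_def by (rule Suc.IH[OF that])
  \<comment> \<open>Summation over the previous spin, for final spin 1 and for final spin -1; a
    disagreement costs \<open>exp (- 2 * J)\<close>.\<close>
  have plus: "exp (A + l) + exp (A - l - 2 * J) = exp (A + l + 2 * wall_cost J (- l))"
    and minus: "exp (A + l - 2 * J) + exp (A - l) = exp (A - l + 2 * wall_cost J l)"
    unfolding exp_add[of _ "2 * _"] exp_wall_cost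
    by (simp_all add: distrib_left algebra_simps flip: exp_add)
  have "partition_fun (Suc (Suc n)) h a b J = exp (A + gain J l + of_int b * (soft_clip J l + x))"
  proof (cases "b = 1")
    case True
    have "partition_fun (Suc (Suc n)) h a b J = (exp (A + l) + exp (A - l - 2 * J)) * exp x"
      unfolding partition_fun_Suc[OF Suc.prems]
      using True by (simp add: IH x_def algebra_simps flip: exp_add)
    also have "\<dots> = exp (A + gain J l + of_int b * (soft_clip J l + x))"
      unfolding plus using True by (simp add: gain_def soft_clip_def algebra_simps flip: exp_add)
    finally show ?thesis .
  next
    case False
    then have b: "b = -1" using Suc.prems by auto
    have "partition_fun (Suc (Suc n)) h a b J = (exp (A + l - 2 * J) + exp (A - l)) * exp (- x)"
      unfolding partition_fun_Suc[OF Suc.prems]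
      using b by (simp add: IH x_def algebra_simps flip: exp_add)
    also have "\<dots> = exp (A + gain J l + of_int b * (soft_clip J l + x))"
      unfolding minus using b by (simp add: gain_def soft_clip_def algebra_simps flip: exp_add)
    finally show ?thesis .
  qed
  then show ?case by (simp add: A_def l_def x_def algebra_simps)
qed

text \<open>Adaptedness: the field with index \<open>Suc m\<close> can be resampled without
  disturbing the past of the chain.\<close>

lemma chain_cong: "n \<le> m \<Longrightarrow> chain J t (h(Suc m := x)) n = chain J t h n"
  by (induction n) auto

section \<open>Law of large numbers for the accumulated gain\<close>

context ising_chain
begin

lemma prob_space_field: "prob_space (field_measure \<mu>)"
  unfolding field_measure_def by (intro prob_space_PiM prob_space_axioms)

lemma field_component_measurable [measurable]:
  "(\<lambda>h. h (Suc n)) \<in> borel_measurable (field_measure \<mu>)"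
proof -
  have "(\<lambda>h. h (Suc n)) \<in> measurable (field_measure \<mu>) \<mu>"
    unfolding field_measure_def by (rule measurable_component_singleton) simp
  then show ?thesis by (simp cong: measurable_cong_sets)
qed

lemma distr_field_component: "distr (field_measure \<mu>) borel (\<lambda>h. h (Suc n)) = \<mu>"
proof -
  have "distr (field_measure \<mu>) \<mu> (\<lambda>h. h (Suc n)) = \<mu>"
    unfolding field_measure_def by (rule distr_PiM_component) (auto intro: prob_space_axioms)
  then show ?thesis by (simp cong: distr_cong)
qed

lemma integrable_field_component:
  fixes f :: "real \<Rightarrow> real"
  assumes [measurable]: "f \<in> borel_measurable borel" and "integrable \<mu> f"
  shows "integrable (field_measure \<mu>) (\<lambda>h. f (h (Suc n)))"
  using assms(2) integrable_distr_eq[of "\<lambda>h. h (Suc n)" "field_measure \<mu>" borel f]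
  by (simp add: distr_field_component)

lemma integral_field_component:
  fixes f :: "real \<Rightarrow> real"
  assumes [measurable]: "f \<in> borel_measurable borel"
  shows "(\<integral>h. f (h (Suc n)) \<partial>field_measure \<mu>) = (\<integral>x. f x \<partial>\<mu>)"
  using integral_distr[of "\<lambda>h. h (Suc n)" "field_measure \<mu>" borel f]
  by (simp add: distr_field_component)

text \<open>Overwriting one coordinate by an independent copy preserves the product measure. This
  takes the place of conditioning on the other coordinates.\<close>

lemma integral_resample:
  fixes f :: "(nat \<Rightarrow> real) \<Rightarrow> real"
  assumes f: "integrable (field_measure \<mu>) f"
  shows "(\<integral>h. f h \<partial>field_measure \<mu>) = (\<integral>h. (\<integral>x. f (h(Suc n := x)) \<partial>\<mu>) \<partial>field_measure \<mu>)"
proof -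
  let ?M = "field_measure \<mu>"
  interpret M: prob_space ?M by (rule prob_space_field)
  interpret P: pair_sigma_finite \<mu> ?M ..
  \<comment> \<open>The coordinate already belongs to the index set, so the insertion keeps the
    product while the update overwrites the old value.\<close>
  have ins: "insert (Suc n) {1..} = {1..}" by auto
  have d: "distr (\<mu> \<Otimes>\<^sub>M ?M) ?M (\<lambda>(x, h). h(Suc n := x)) = ?M"
    using distr_pair_PiM_eq_PiM[of "{1..}" "\<lambda>_. \<mu>" "Suc n"] prob_space_axioms
    unfolding ins field_measure_def by simp
  have [measurable]: "(\<lambda>(x, h). h(Suc n := x)) \<in> measurable (\<mu> \<Otimes>\<^sub>M ?M) ?M"
    using measurable_add_dim[of "Suc n" "{1..}" "\<lambda>_. \<mu>"]
    unfolding ins field_measure_def split_beta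
    by (intro measurable_fun_upd[where J="{1..}"]) auto
  have int: "integrable (\<mu> \<Otimes>\<^sub>M ?M) (\<lambda>(x, h). f (h(Suc n := x)))"
    using f integrable_distr_eq[of "\<lambda>(x, h). h(Suc n := x)" "\<mu> \<Otimes>\<^sub>M ?M" ?M f] unfolding d
    by (simp add: case_prod_beta' borel_measurable_integrable)
  have "(\<integral>h. f h \<partial>?M) = (\<integral>z. f ((\<lambda>(x, h). h(Suc n := x)) z) \<partial>(\<mu> \<Otimes>\<^sub>M ?M))"
    by (subst d[symmetric], rule integral_distr) (use f in \<open>auto intro: borel_measurable_integrable\<close>)
  also have "\<dots> = (\<integral>h. (\<integral>x. f (h(Suc n := x)) \<partial>\<mu>) \<partial>?M)"
    using P.integral_snd[OF int] by (simp add: case_prod_beta')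
  finally show ?thesis .
qed

lemma chain_measurable [measurable]: "(\<lambda>h. chain J t h n) \<in> borel_measurable (field_measure \<mu>)"
  by (induction n) simp_all

lemma chain_in_range: "\<bar>t\<bar> \<le> J \<Longrightarrow> \<bar>chain J t h n\<bar> \<le> J"
  using abs_soft_clip_le[of J] J_pos by (cases n) auto

text \<open>The summands below are martingale differences because \<open>U\<close> solves the Poisson equation.\<close>

lemma sum_increments_second_moment:
  assumes U: "\<And>s t. \<bar>U s - U t\<bar> \<le> L * \<bar>s - t\<bar>" "\<And>t. bellman U t = F + U t"
    and t: "\<bar>t\<bar> \<le> J"
  defines "Y \<equiv> \<lambda>i h. gain J (chain J t h i + h (Suc i)) + U (chain J t h (Suc i)) - U (chain J t h i) - F"
  shows "\<exists>K. \<forall>n. integrable (field_measure \<mu>) (\<lambda>h. (\<Sum>i<n. Y i h)\<^sup>2) \<and>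
    (\<integral>h. (\<Sum>i<n. Y i h)\<^sup>2 \<partial>field_measure \<mu>) \<le> K * real n"
proof -
  let ?M = "field_measure \<mu>"
  interpret M: prob_space ?M by (rule prob_space_field)
  have L: "0 \<le> L" using U(1)[of 1 0] by (simp add: order_trans[OF abs_ge_zero])
  have cont: "continuous_on UNIV U" by (rule lipschitz_continuous[OF U(1)])
  then have [measurable]: "U \<in> borel_measurable borel" by (rule borel_measurable_continuous_onI)
  have [measurable]: "Y i \<in> borel_measurable ?M" for i unfolding Y_def by measurable
  define C where "C = gain J 0 + J + L * (2 * J) + \<bar>F\<bar>"
  define K where "K = 2 * (\<integral>x. x\<^sup>2 \<partial>\<mu>) + 2 * C\<^sup>2"
  \<comment> \<open>The chain stays in [-J, J], so everything except the current field is bounded by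
    a constant.\<close>
  have Ybound: "\<bar>Y i h\<bar> \<le> \<bar>h (Suc i)\<bar> + C" for i h
  proof -
    have c: "\<bar>chain J t h i\<bar> \<le> J" "\<bar>chain J t h (Suc i)\<bar> \<le> J" by (rule chain_in_range[OF t])+
    have "gain J (chain J t h i + h (Suc i)) \<le> gain J 0 + J + \<bar>h (Suc i)\<bar>"
      using gain_lipschitz[of J "chain J t h i + h (Suc i)" 0] c(1) by linarith
    moreover have "L * \<bar>chain J t h (Suc i) - chain J t h i\<bar> \<le> L * (2 * J)"
      using c L by (intro mult_left_mono) linarith+
    moreover note U(1)[of "chain J t h (Suc i)" "chain J t h i"] gain_nonneg[of J "chain J t h i + h (Suc i)"]
    ultimately show ?thesis unfolding Y_def C_def by linarith
  qed
  have Y2bound: "(Y i h)\<^sup>2 \<le> 2 * (h (Suc i))\<^sup>2 + 2 * C\<^sup>2" for i h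
  proof -
    have "(Y i h)\<^sup>2 \<le> (\<bar>h (Suc i)\<bar> + C)\<^sup>2"
      using power_mono[OF Ybound[of i h], of 2] by simp
    also have "\<dots> \<le> 2 * (h (Suc i))\<^sup>2 + 2 * C\<^sup>2"
      using zero_le_power2[of "\<bar>h (Suc i)\<bar> - C"] by (simp add: power2_sum power2_diff)
    finally show ?thesis .
  qed
  have h2int: "integrable ?M (\<lambda>h. (h (Suc i))\<^sup>2)" for i
    by (rule integrable_field_component[OF _ square_integrable]) simp
  have hint: "integrable ?M (\<lambda>h. 2 * (h (Suc i))\<^sup>2 + 2 * C\<^sup>2)" for i
    using h2int by simp
  have Yint: "integrable ?M (\<lambda>h. (Y i h)\<^sup>2)" for i
    by (rule Bochner_Integration.integrable_bound[OF hint[of i]]) (use Y2bound in auto)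
  have YK: "(\<integral>h. (Y i h)\<^sup>2 \<partial>?M) \<le> K" for i
  proof -
    have "(\<integral>h. (Y i h)\<^sup>2 \<partial>?M) \<le> (\<integral>h. 2 * (h (Suc i))\<^sup>2 + 2 * C\<^sup>2 \<partial>?M)"
      by (intro integral_mono Yint hint Y2bound)
    also have "\<dots> = K"
      using integral_field_component[of "\<lambda>x. x\<^sup>2" i] h2int[of i]
      by (simp add: K_def M.prob_space)
    finally show ?thesis .
  qed
  let ?S = "\<lambda>n h. \<Sum>i<n. Y i h"
  \<comment> \<open>Orthogonality makes the second moments add up, hence the linear growth in
    \<open>n\<close>.\<close>
  have main: "integrable ?M (\<lambda>h. (?S n h)\<^sup>2) \<and> (\<integral>h. (?S n h)\<^sup>2 \<partial>?M) \<le> K * real n" for n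
  proof (induction n)
    case (Suc n)
    then have Sint: "integrable ?M (\<lambda>h. (?S n h)\<^sup>2)" by simp
    have SYint: "integrable ?M (\<lambda>h. ?S n h * Y n h)"
    proof (rule Bochner_Integration.integrable_bound)
      show "integrable ?M (\<lambda>h. (?S n h)\<^sup>2 + (Y n h)\<^sup>2)" using Sint Yint by simp
      have "\<bar>a * b\<bar> \<le> a\<^sup>2 + b\<^sup>2" for a b :: real
        using sum_squares_bound[of "\<bar>a\<bar>" "\<bar>b\<bar>"] mult_nonneg_nonneg[of "\<bar>a\<bar>" "\<bar>b\<bar>"]
        unfolding abs_mult power2_abs by linarith
      then show "AE h in ?M. norm (?S n h * Y n h) \<le> norm ((?S n h)\<^sup>2 + (Y n h)\<^sup>2)"
        by (intro AE_I2) simp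
    qed simp
    have "(\<integral>h. ?S n h * Y n h \<partial>?M) = (\<integral>h. (\<integral>x. ?S n (h(Suc n := x)) * Y n (h(Suc n := x)) \<partial>\<mu>) \<partial>?M)"
      by (rule integral_resample[OF SYint])
    \<comment> \<open>Resampling leaves the earlier sum unchanged, and the inner integral of the
      last increment vanishes by the Poisson equation.\<close>
    also have "\<dots> = (\<integral>h. 0 \<partial>?M)"
    proof (intro Bochner_Integration.integral_cong refl)
      fix h
      have "?S n (h(Suc n := x)) = ?S n h" for x
        by (intro sum.cong refl) (simp add: Y_def chain_cong)
      moreover have "Y n (h(Suc n := x)) = gain J (chain J t h n + x) + U (soft_clip J (chain J t h n + x))
          - (U (chain J t h n) + F)" for x
        by (simp add: Y_def chain_cong)
      moreover have "(\<integral>x. gain J (chain J t h n + x) + U (soft_clip J (chain J t h n + x))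
          - (U (chain J t h n) + F) \<partial>\<mu>) = 0"
        using U(2)[of "chain J t h n"] integrable_gain integrable_clip[OF cont]
        by (simp add: bellman_def prob_space)
      ultimately show "(\<integral>x. ?S n (h(Suc n := x)) * Y n (h(Suc n := x)) \<partial>\<mu>) = 0"
        by simp
    qed
    finally have cross: "(\<integral>h. ?S n h * Y n h \<partial>?M) = 0" by simp
    have eq: "(?S (Suc n) h)\<^sup>2 = (?S n h)\<^sup>2 + 2 * (?S n h * Y n h) + (Y n h)\<^sup>2" for h
      by (simp add: power2_sum)
    have "(\<integral>h. (?S (Suc n) h)\<^sup>2 \<partial>?M) = (\<integral>h. (?S n h)\<^sup>2 \<partial>?M) + (\<integral>h. (Y n h)\<^sup>2 \<partial>?M)"
      unfolding eq using Sint SYint Yint[of n] cross by simp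
    then show ?case
      unfolding eq using Sint SYint Yint[of n] YK[of n] Suc.IH by (simp add: algebra_simps)
  qed simp
  then show ?thesis by blast
qed

text \<open>This removes the last field, which enters the log-weight without passing through the
  clip. The second moments of the quotients are of order 1 / n^2.\<close>

lemma AE_field_over_n: "AE h in field_measure \<mu>. (\<lambda>n. h (Suc n) / real (Suc n)) \<longlonglongrightarrow> 0"
proof (rule AE_tendsto_zero_of_summable_second_moment)
  show "summable (\<lambda>n. (\<integral>x. x\<^sup>2 \<partial>\<mu>) * (1 / (real (Suc n))\<^sup>2))"
    using inverse_power_summable[of 2, where ?'a=real]
    by (intro summable_mult) (subst summable_Suc_iff, simp add: divide_inverse power_inverse)
  show "integrable (field_measure \<mu>) (\<lambda>h. (h (Suc n) / real (Suc n))\<^sup>2)" for n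
    using integrable_field_component[OF _ square_integrable, of n] by (simp add: power_divide del: of_nat_Suc)
  show "(\<integral>h. (h (Suc n) / real (Suc n))\<^sup>2 \<partial>field_measure \<mu>) \<le> (\<integral>x. x\<^sup>2 \<partial>\<mu>) * (1 / (real (Suc n))\<^sup>2)" for n
    using integral_field_component[of "\<lambda>x. x\<^sup>2" n] by (simp add: power_divide del: of_nat_Suc)
qed

text \<open>Up to a bounded telescoping term the accumulated gain is \<open>n * F\<close> plus a
  martingale. Along squares the normalised martingale has second moment at most \<open>K\<close> /
  k^2, which is summable; nonnegativity of the gain fills in the other times.\<close>

lemma AE_average_gain:
  assumes U: "\<And>s t. \<bar>U s - U t\<bar> \<le> L * \<bar>s - t\<bar>" "\<And>t. bellman U t = F + U t"
    and t: "\<bar>t\<bar> \<le> J"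
  shows "AE h in field_measure \<mu>. (\<lambda>n. (\<Sum>i<n. gain J (chain J t h i + h (Suc i))) / real n) \<longlonglongrightarrow> F"
proof -
  let ?Y = "\<lambda>i h. gain J (chain J t h i + h (Suc i)) + U (chain J t h (Suc i)) - U (chain J t h i) - F"
  obtain K where K: "\<And>n. integrable (field_measure \<mu>) (\<lambda>h. (\<Sum>i<n. ?Y i h)\<^sup>2)"
    "\<And>n. (\<integral>h. (\<Sum>i<n. ?Y i h)\<^sup>2 \<partial>field_measure \<mu>) \<le> K * real n"
    using sum_increments_second_moment[OF U t] by blast
  have L: "0 \<le> L" using U(1)[of 1 0] by (simp add: order_trans[OF abs_ge_zero])
  have "AE h in field_measure \<mu>. (\<lambda>k. (\<Sum>i<k\<^sup>2. ?Y i h) / (real k)\<^sup>2) \<longlonglongrightarrow> 0"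
  proof (rule AE_tendsto_zero_of_summable_second_moment)
    show "integrable (field_measure \<mu>) (\<lambda>h. ((\<Sum>i<k\<^sup>2. ?Y i h) / (real k)\<^sup>2)\<^sup>2)" for k
      using K(1)[of "k\<^sup>2"] by (simp add: power_divide)
    show "summable (\<lambda>k. K * (1 / (real k)\<^sup>2))"
      using inverse_power_summable[of 2] by (intro summable_mult) (simp add: divide_inverse power_inverse[symmetric])
    show "(\<integral>h. ((\<Sum>i<k\<^sup>2. ?Y i h) / (real k)\<^sup>2)\<^sup>2 \<partial>field_measure \<mu>) \<le> K * (1 / (real k)\<^sup>2)" for k
    \<comment> \<open>At 0 both sides vanish, since division by zero yields zero.\<close>
    proof (cases "k = 0")
      case False
      have "(\<integral>h. ((\<Sum>i<k\<^sup>2. ?Y i h) / (real k)\<^sup>2)\<^sup>2 \<partial>field_measure \<mu>)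
          = (\<integral>h. (\<Sum>i<k\<^sup>2. ?Y i h)\<^sup>2 \<partial>field_measure \<mu>) / ((real k)\<^sup>2)\<^sup>2"
        by (simp add: power_divide)
      also have "\<dots> \<le> K * real (k\<^sup>2) / ((real k)\<^sup>2)\<^sup>2"
        by (intro divide_right_mono K) auto
      also have "\<dots> = K * (1 / (real k)\<^sup>2)"
        using False by (simp add: power2_eq_square)
      finally show ?thesis .
    qed simp
  qed
  then show ?thesis
  proof eventually_elim
    case (elim h)
    let ?A = "\<lambda>n. \<Sum>i<n. gain J (chain J t h i + h (Suc i))"
    have tele: "?A n = (\<Sum>i<n. ?Y i h) - (U (chain J t h n) - U t) + real n * F" for n
      by (induction n) (auto simp: algebra_simps)
    have "(\<lambda>k. (U (chain J t h (k\<^sup>2)) - U t) / (real k)\<^sup>2) \<longlonglongrightarrow> 0"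
    proof (rule Lim_null_comparison)
      show "\<forall>\<^sub>F k in sequentially. norm ((U (chain J t h (k\<^sup>2)) - U t) / (real k)\<^sup>2) \<le> L * (2 * J) / (real k)\<^sup>2"
      proof (intro always_eventually allI)
        fix k
        have "L * \<bar>chain J t h (k\<^sup>2) - t\<bar> \<le> L * (2 * J)"
          using chain_in_range[OF t, of h "k\<^sup>2"] t L by (intro mult_left_mono) linarith+
        then show "norm ((U (chain J t h (k\<^sup>2)) - U t) / (real k)\<^sup>2) \<le> L * (2 * J) / (real k)\<^sup>2"
          using U(1)[of "chain J t h (k\<^sup>2)" t] by (simp add: divide_right_mono)
      qed
      show "(\<lambda>k. L * (2 * J) / (real k)\<^sup>2) \<longlonglongrightarrow> 0"
        by (intro tendsto_divide_0[OF tendsto_const] filterlim_at_top_imp_at_infinity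
            filterlim_pow_at_top filterlim_real_sequentially) simp
    qed
    from tendsto_add[OF tendsto_diff[OF elim this] tendsto_const[of F]]
    have "(\<lambda>k. (\<Sum>i<k\<^sup>2. ?Y i h) / (real k)\<^sup>2 - (U (chain J t h (k\<^sup>2)) - U t) / (real k)\<^sup>2 + F) \<longlonglongrightarrow> F"
      by simp
    then have "(\<lambda>k. ?A (k\<^sup>2) / (real k)\<^sup>2) \<longlonglongrightarrow> F"
    proof (rule Lim_transform_eventually)
      show "\<forall>\<^sub>F k in sequentially. (\<Sum>i<k\<^sup>2. ?Y i h) / (real k)\<^sup>2 - (U (chain J t h (k\<^sup>2)) - U t) / (real k)\<^sup>2 + F
          = ?A (k\<^sup>2) / (real k)\<^sup>2"
        using eventually_gt_at_top[of 0]
        by eventually_elim (simp add: tele add_divide_distrib diff_divide_distrib)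
    qed
    then show ?case
      by (intro LIMSEQ_average_from_squares) (auto intro!: incseq_SucI sum_nonneg gain_nonneg)
  qed
qed

text \<open>The chains started at -J and J cover both left boundary spins. The right boundary spin
  and the last field only change a term that vanishes after division by the length.\<close>

lemma free_energy_eq:
  assumes U: "\<And>s t. \<bar>U s - U t\<bar> \<le> L * \<bar>s - t\<bar>" "\<And>t. bellman U t = F + U t"
  shows "free_energy \<mu> J = F"
proof -
  let ?M = "field_measure \<mu>"
  interpret M: prob_space ?M by (rule prob_space_field)
  let ?P = "\<lambda>F. AE h in ?M. \<forall>a\<in>{-1, 1}. \<forall>b\<in>{-1, 1}.
       (\<lambda>N. ln (partition_fun N h a b J) / real N) \<longlonglongrightarrow> F"
  have abs_J: "\<bar>- J\<bar> \<le> J" "\<bar>J\<bar> \<le> J" using J_pos by auto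
  have "?P F"
    using AE_average_gain[OF U abs_J(1)] AE_average_gain[OF U abs_J(2)] AE_field_over_n
  proof eventually_elim
    case (elim h)
    show ?case
    proof (intro ballI)
      fix a b :: int assume ab: "a \<in> {-1, 1}" "b \<in> {-1, 1}"
      let ?t = "of_int a * J"
      let ?A = "\<lambda>n. \<Sum>i<n. gain J (chain J ?t h i + h (Suc i))"
      have t: "\<bar>?t\<bar> \<le> J" using ab J_pos by auto
      have A: "(\<lambda>n. ?A n / real n) \<longlonglongrightarrow> F"
        using elim J_pos ab by auto
      \<comment> \<open>A chain of length \<open>Suc n\<close> carries \<open>n\<close> gains, hence
        the change of divisor; for \<open>n = 0\<close> both sides are zero.\<close>
      have "?A n / real n * (real n / real (Suc n)) = ?A n / real (Suc n)" for n
        by (cases n) (auto simp del: of_nat_Suc)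
      then have A': "(\<lambda>n. ?A n / real (Suc n)) \<longlonglongrightarrow> F"
        using tendsto_mult[OF A LIMSEQ_n_over_Suc_n] by simp
      have c: "(\<lambda>n. (of_int b * chain J ?t h n - J) / real (Suc n)) \<longlonglongrightarrow> 0"
      proof (rule Lim_null_comparison)
        show "\<forall>\<^sub>F n in sequentially. norm ((of_int b * chain J ?t h n - J) / real (Suc n)) \<le> 2 * J / real (Suc n)"
        proof (intro always_eventually allI)
          fix n
          have "\<bar>of_int b * chain J ?t h n - J\<bar> \<le> 2 * J"
            using chain_in_range[OF t, of h n] ab(2) J_pos by auto
          then show "norm ((of_int b * chain J ?t h n - J) / real (Suc n)) \<le> 2 * J / real (Suc n)"
            by (simp add: divide_right_mono del: of_nat_Suc)
        qed
        show "(\<lambda>n. 2 * J / real (Suc n)) \<longlonglongrightarrow> 0"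
          using LIMSEQ_Suc[OF lim_const_over_n[of "2 * J"]] by simp
      qed
      have "(\<lambda>n. ?A n / real (Suc n) + (of_int b * chain J ?t h n - J) / real (Suc n)
          + of_int b * (h (Suc n) / real (Suc n))) \<longlonglongrightarrow> F + 0 + of_int b * 0"
        by (intro tendsto_add tendsto_mult A' c tendsto_const elim)
      moreover have "ln (partition_fun (Suc n) h a b J) / real (Suc n)
          = ?A n / real (Suc n) + (of_int b * chain J ?t h n - J) / real (Suc n)
          + of_int b * (h (Suc n) / real (Suc n))" for n
        unfolding partition_fun_eq[OF ab] ln_exp
        by (simp add: add_divide_distrib diff_divide_distrib algebra_simps del: of_nat_Suc)
      ultimately have "(\<lambda>n. ln (partition_fun (Suc n) h a b J) / real (Suc n)) \<longlonglongrightarrow> F"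
        by simp
      then show "(\<lambda>N. ln (partition_fun N h a b J) / real N) \<longlonglongrightarrow> F"
        by (rule LIMSEQ_imp_Suc)
    qed
  qed
  \<comment> \<open>Constants that agree almost surely on a probability space agree; this gives the
    uniqueness that \<open>THE\<close> demands.\<close>
  moreover have "F' = F" if "?P F'" for F'
  proof -
    have "AE h in ?M. F' = F"
      using that \<open>?P F\<close> by eventually_elim (auto dest: LIMSEQ_unique)
    then show ?thesis by (simp add: M.AE_const)
  qed
  ultimately show ?thesis
    unfolding free_energy_def by (intro the_equality)
qed

end

section \<open>Drift inequalities\<close>

text \<open>With Q = r^2 + y (y + x), Lagrange's identity reads (A B)^2 = Q^2 + r^2 x^2. The gap
  above the tangent is (A B - Q) / A, and (A B - Q) (A B + Q) = r^2 x^2.\<close>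

lemma sqrt_convex_bounds:
  fixes r x y :: real
  assumes r: "0 < r"
  defines "A \<equiv> sqrt (r\<^sup>2 + y\<^sup>2)" and "B \<equiv> sqrt (r\<^sup>2 + (y + x)\<^sup>2)"
  shows "A + y / A * x \<le> B"
    and "\<bar>y\<bar> \<le> r \<Longrightarrow> \<bar>x\<bar> \<le> r \<Longrightarrow> A + y / A * x + x\<^sup>2 / (10 * r) \<le> B"
    and "\<bar>y / A\<bar> \<le> 1"
proof -
  define Q where "Q = r\<^sup>2 + y * (y + x)"
  have r2: "0 < r\<^sup>2" using r by simp
  have A: "0 < A" "A\<^sup>2 = r\<^sup>2 + y\<^sup>2" and B: "0 < B" "B\<^sup>2 = r\<^sup>2 + (y + x)\<^sup>2"
    using r2 by (auto simp: A_def B_def add_pos_nonneg)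
  have sq: "(A * B)\<^sup>2 = Q\<^sup>2 + r\<^sup>2 * x\<^sup>2"
    unfolding power_mult_distrib A B Q_def by (simp add: power2_eq_square algebra_simps)
  have AQ: "A * B \<ge> Q"
    by (rule power2_le_imp_le) (use sq A B in auto)
  have eq: "B - (A + y / A * x) = (A * B - Q) / A"
    using A by (simp add: divide_simps Q_def) (simp add: power2_eq_square algebra_simps)
  show "A + y / A * x \<le> B"
    using eq AQ A divide_nonneg_pos[of "A * B - Q" A] by linarith
  show "\<bar>y / A\<bar> \<le> 1"
  proof -
    have "\<bar>y\<bar> \<le> A" by (rule power2_le_imp_le) (use A in auto)
    then show ?thesis using A by (simp add: abs_divide)
  qed
  assume y: "\<bar>y\<bar> \<le> r" and x: "\<bar>x\<bar> \<le> r"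
  have y2: "y\<^sup>2 \<le> r\<^sup>2" using power_mono[OF y, of 2] by simp
  have "\<bar>y + x\<bar> \<le> 2 * r" using x y by linarith
  then have yx2: "(y + x)\<^sup>2 \<le> 4 * r\<^sup>2" using power_mono[of "\<bar>y + x\<bar>" "2 * r" 2] by simp
  \<comment> \<open>For arguments up to \<open>r\<close>: A \<le> 3/2 r, B \<le> 9/4 r and Q \<le> 3
    r^2, so A B + Q \<le> 51/8 r^2. The factor 10 in the claim works because 3/20 \<le>
    8/51.\<close>
  have "A\<^sup>2 \<le> (3 / 2 * r)\<^sup>2"
    unfolding A power_mult_distrib using y2 r2 by (simp add: power2_eq_square)
  then have A': "A \<le> 3 / 2 * r" by (rule power2_le_imp_le) (use r in auto)
  have "B\<^sup>2 \<le> (9 / 4 * r)\<^sup>2"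
    unfolding B power_mult_distrib using yx2 r2 by (simp add: power2_eq_square)
  then have B': "B \<le> 9 / 4 * r" by (rule power2_le_imp_le) (use r in auto)
  have "y * (y + x) \<le> \<bar>y\<bar> * \<bar>y + x\<bar>" by (metis abs_ge_self abs_mult)
  also have "\<dots> \<le> r * (2 * r)" using y x r by (intro mult_mono) auto
  finally have Q': "Q \<le> 3 * r\<^sup>2" by (simp add: Q_def power2_eq_square)
  have "A * B \<le> 3 / 2 * r * (9 / 4 * r)" using A' B' A B r by (intro mult_mono) auto
  then have AB: "A * B + Q \<le> 51 / 8 * r\<^sup>2" using Q' by (simp add: power2_eq_square)
  have "r\<^sup>2 * x\<^sup>2 = (A * B - Q) * (A * B + Q)"
    using sq by (simp add: power2_eq_square algebra_simps)
  also have "\<dots> \<le> (A * B - Q) * (51 / 8 * r\<^sup>2)"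
    using AQ AB by (intro mult_left_mono) auto
  finally have "r\<^sup>2 * x\<^sup>2 \<le> r\<^sup>2 * ((A * B - Q) * (51 / 8))" by (simp add: algebra_simps)
  then have x2: "x\<^sup>2 \<le> (A * B - Q) * (51 / 8)" using r2 by simp
  have "x\<^sup>2 / (10 * r) * A \<le> x\<^sup>2 / (10 * r) * (3 / 2 * r)"
    using A' r by (intro mult_left_mono) auto
  also have "\<dots> = x\<^sup>2 * 3 / 20" using r by simp
  also have "\<dots> \<le> A * B - Q" using x2 AQ by simp
  finally have "x\<^sup>2 / (10 * r) \<le> (A * B - Q) / A"
    using A by (simp add: pos_le_divide_eq)
  then show "A + y / A * x + x\<^sup>2 / (10 * r) \<le> B" using eq by linarith
qed

text \<open>A smoothing of \<open>r\<close> times the sum of the distances to J and -J. Each root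
  has curvature of order 1 / r within distance \<open>r\<close> of its centre; the factor
  \<open>r\<close> raises this to order one, at the price of slopes up to
  \<open>2 * r\<close>.\<close>

definition barrier :: "real \<Rightarrow> real \<Rightarrow> real \<Rightarrow> real" where
  "barrier J r x = r * (sqrt (r\<^sup>2 + (x - J)\<^sup>2) + sqrt (r\<^sup>2 + (x + J)\<^sup>2))"

lemma continuous_on_barrier: "continuous_on A (barrier J r)"
  unfolding barrier_def[abs_def] by (intro continuous_intros)

text \<open>Each root lies above tangents of slope at most 1. With
  \<open>abs_soft_clip_diff_le\<close> this bounds the loss caused by clipping by
  \<open>2 * r\<close> times the gain.\<close>

lemma barrier_lipschitz:
  assumes "0 < r" shows "barrier J r k - 2 * r * \<bar>l - k\<bar> \<le> barrier J r l"
proof -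
  have *: "sqrt (r\<^sup>2 + (k + c)\<^sup>2) - \<bar>l - k\<bar> \<le> sqrt (r\<^sup>2 + (l + c)\<^sup>2)" for c
  proof -
    define d where "d = (k + c) / sqrt (r\<^sup>2 + (k + c)\<^sup>2) * (l - k)"
    have "\<bar>d\<bar> \<le> 1 * \<bar>l - k\<bar>"
      unfolding abs_mult d_def by (intro mult_right_mono sqrt_convex_bounds(3)[OF assms]) simp
    moreover have eq: "k + c + (l - k) = l + c" by simp
    have "sqrt (r\<^sup>2 + (k + c)\<^sup>2) + d \<le> sqrt (r\<^sup>2 + (l + c)\<^sup>2)"
      using sqrt_convex_bounds(1)[OF assms, of "k + c" "l - k"] unfolding d_def eq .
    moreover have "A - y \<le> B" if "\<bar>z\<bar> \<le> 1 * y" "A + z \<le> B" for A B y z :: real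
      using that by linarith
    ultimately show ?thesis by blast
  qed
  have "r * (sqrt (r\<^sup>2 + (k - J)\<^sup>2) + sqrt (r\<^sup>2 + (k + J)\<^sup>2) - 2 * \<bar>l - k\<bar>)
      \<le> r * (sqrt (r\<^sup>2 + (l - J)\<^sup>2) + sqrt (r\<^sup>2 + (l + J)\<^sup>2))"
    using *[of J] *[of "- J"] assms by (intro mult_left_mono) auto
  then show ?thesis by (simp add: barrier_def algebra_simps)
qed

text \<open>The number \<open>k\<close> is the slope at \<open>t\<close>; it may stay existential
  because its term integrates to zero against a centred law.\<close>

lemma barrier_convex:
  assumes r: "0 < r" and t: "\<bar>t\<bar> \<le> J"
  shows "\<exists>k. \<forall>x. barrier J r t + k * x + (if J - r \<le> \<bar>t\<bar> \<and> \<bar>x\<bar> \<le> r then x\<^sup>2 / 10 else 0)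
    \<le> barrier J r (t + x)"
proof -
  define a where "a y = y / sqrt (r\<^sup>2 + y\<^sup>2)" for y
  have lin: "sqrt (r\<^sup>2 + y\<^sup>2) + a y * x \<le> sqrt (r\<^sup>2 + (y + x)\<^sup>2)" for x y
    unfolding a_def by (rule sqrt_convex_bounds(1)[OF r])
  have quad: "sqrt (r\<^sup>2 + y\<^sup>2) + a y * x + x\<^sup>2 / (10 * r) \<le> sqrt (r\<^sup>2 + (y + x)\<^sup>2)"
    if "\<bar>y\<bar> \<le> r" "\<bar>x\<bar> \<le> r" for x y
    unfolding a_def by (rule sqrt_convex_bounds(2)[OF r that])
  have "barrier J r t + r * (a (t - J) + a (t + J)) * x + (if J - r \<le> \<bar>t\<bar> \<and> \<bar>x\<bar> \<le> r then x\<^sup>2 / 10 else 0)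
    \<le> barrier J r (t + x)" for x
  proof -
    define e where "e = (if J - r \<le> \<bar>t\<bar> \<and> \<bar>x\<bar> \<le> r then x\<^sup>2 / (10 * r) else 0)"
    have re: "(if J - r \<le> \<bar>t\<bar> \<and> \<bar>x\<bar> \<le> r then x\<^sup>2 / 10 else 0) = r * e"
      using r by (simp add: e_def)
    have "sqrt (r\<^sup>2 + (t - J)\<^sup>2) + sqrt (r\<^sup>2 + (t + J)\<^sup>2) + (a (t - J) + a (t + J)) * x + e
      \<le> sqrt (r\<^sup>2 + (t - J + x)\<^sup>2) + sqrt (r\<^sup>2 + (t + J + x)\<^sup>2)"
    proof (cases "J - r \<le> \<bar>t\<bar> \<and> \<bar>x\<bar> \<le> r")
      case True
      \<comment> \<open>Only the root centred at the nearby wall supplies the quadratic term; the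
        other contributes its tangent.\<close>
      then consider "\<bar>t - J\<bar> \<le> r" | "\<bar>t + J\<bar> \<le> r" using t by (cases "0 \<le> t") auto
      then show ?thesis
      proof cases
        case 1
        then show ?thesis using True quad[of "t - J" x] lin[of "t + J" x] by (simp add: e_def distrib_right)
      next
        case 2
        then show ?thesis using True quad[of "t + J" x] lin[of "t - J" x] by (simp add: e_def distrib_right)
      qed
    next
      case False
      then show ?thesis using lin[of "t - J" x] lin[of "t + J" x] by (auto simp: e_def distrib_right)
    qed
    from mult_left_mono[OF this, of r] r show ?thesis
      unfolding re by (simp add: barrier_def algebra_simps)
  qed
  then show ?thesis by blast
qed

lemma truncated_square_measurable:
  "(\<lambda>x::real. if \<bar>x\<bar> \<le> r then x\<^sup>2 else 0) \<in> borel_measurable borel"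
  by measurable

section \<open>One-step drift of the barrier and of the square\<close>

context ising_chain
begin

text \<open>Integrate \<open>barrier_convex\<close>: centring kills the linear term, and small
  fields give at least \<open>c\<close> near a wall. The clip then costs at most
  \<open>2 * r\<close> times the gain, which can be absorbed into the coefficient of the free
  energy.\<close>

lemma barrier_drift:
  assumes mean: "(\<integral>x. x \<partial>\<mu>) = 0" and r: "0 < r" and t: "\<bar>t\<bar> \<le> J"
    and c: "c \<le> (\<integral>x. (if \<bar>x\<bar> \<le> r then x\<^sup>2 else 0) \<partial>\<mu>) / 10"
  shows "barrier J r t + (if J - r \<le> \<bar>t\<bar> then c else 0) - 2 * r * (\<integral>x. gain J (t + x) \<partial>\<mu>)
    \<le> (\<integral>x. barrier J r (soft_clip J (t + x)) \<partial>\<mu>)"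
proof -
  obtain k where k: "\<forall>x. barrier J r t + k * x + (if J - r \<le> \<bar>t\<bar> \<and> \<bar>x\<bar> \<le> r then x\<^sup>2 / 10 else 0)
      \<le> barrier J r (t + x)"
    using barrier_convex[OF r t] ..
  have int_t: "integrable \<mu> (\<lambda>x. if \<bar>x\<bar> \<le> r then x\<^sup>2 else 0)"
  proof (rule Bochner_Integration.integrable_bound[OF square_integrable])
    show "(\<lambda>x. if \<bar>x\<bar> \<le> r then x\<^sup>2 else 0) \<in> borel_measurable \<mu>"
      using truncated_square_measurable by (simp cong: measurable_cong_sets)
  qed (intro AE_I2, simp)
  let ?c = "\<lambda>x. if J - r \<le> \<bar>t\<bar> then (if \<bar>x\<bar> \<le> r then x\<^sup>2 else 0) / 10 else 0"
  have int_c: "integrable \<mu> ?c" using int_t by (cases "J - r \<le> \<bar>t\<bar>") simp_all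
  have "barrier J r t + (if J - r \<le> \<bar>t\<bar> then c else 0) - 2 * r * (\<integral>x. gain J (t + x) \<partial>\<mu>)
      \<le> barrier J r t + (\<integral>x. ?c x \<partial>\<mu>) - 2 * r * (\<integral>x. gain J (t + x) \<partial>\<mu>)"
    using c by auto
  also have "\<dots> = (\<integral>x. barrier J r t + k * x + ?c x - 2 * r * gain J (t + x) \<partial>\<mu>)"
    using integrable_id int_c integrable_gain[of t] mean by (simp add: prob_space del: integral_divide_zero)
  also have "\<dots> \<le> (\<integral>x. barrier J r (soft_clip J (t + x)) \<partial>\<mu>)"
  proof (rule integral_mono)
    fix x
    have "2 * r * \<bar>soft_clip J (t + x) - (t + x)\<bar> \<le> 2 * r * gain J (t + x)"
      using abs_soft_clip_diff_le r by (intro mult_left_mono) auto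
    then show "barrier J r t + k * x + ?c x - 2 * r * gain J (t + x) \<le> barrier J r (soft_clip J (t + x))"
      using k[rule_format, of x] barrier_lipschitz[OF r, of J "t + x" "soft_clip J (t + x)"] by (auto split: if_splits)
  qed (use integrable_id int_c integrable_gain[of t] in \<open>auto intro: integrable_clip continuous_on_barrier\<close>)
  finally show ?thesis .
qed

lemma second_moment_shift:
  assumes mean: "(\<integral>x. x \<partial>\<mu>) = 0"
  shows "integrable \<mu> (\<lambda>x. (t + x)\<^sup>2)" "(\<integral>x. (t + x)\<^sup>2 \<partial>\<mu>) = t\<^sup>2 + (\<integral>x. x\<^sup>2 \<partial>\<mu>)"
proof -
  have eq: "(t + x)\<^sup>2 = t\<^sup>2 + 2 * t * x + x\<^sup>2" for x by (simp add: power2_sum)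
  show "integrable \<mu> (\<lambda>x. (t + x)\<^sup>2)" "(\<integral>x. (t + x)\<^sup>2 \<partial>\<mu>) = t\<^sup>2 + (\<integral>x. x\<^sup>2 \<partial>\<mu>)"
    unfolding eq using integrable_id square_integrable mean by (simp_all add: prob_space)
qed

lemma integrable_clip_square: "integrable \<mu> (\<lambda>x. (soft_clip J (t + x))\<^sup>2)"
  by (rule integrable_clip[where W="\<lambda>y. y\<^sup>2"]) (intro continuous_intros)

text \<open>Integrate \<open>gain_upper\<close>. Away from the walls the exponential error is small:
  either the field is at least r / 2, and 4 \<le> 16 x^2 / r, or \<open>t + x\<close> keeps distance
  r / 2 from the walls, and exp (- r / 2) \<le> 2 / r.\<close>

lemma square_drift_upper:
  assumes mean: "(\<integral>x. x \<partial>\<mu>) = 0" and r: "1 \<le> r" and t: "\<bar>t\<bar> \<le> J"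
  shows "2 * J * (\<integral>x. gain J (t + x) \<partial>\<mu>) + (\<integral>x. (soft_clip J (t + x))\<^sup>2 \<partial>\<mu>)
    \<le> t\<^sup>2 + (\<integral>x. x\<^sup>2 \<partial>\<mu>) + (if J - r \<le> \<bar>t\<bar> then 4 else 0) + (8 + 16 * (\<integral>x. x\<^sup>2 \<partial>\<mu>)) / r"
proof -
  let ?i = "if J - r \<le> \<bar>t\<bar> then 4 else (0::real)"
  note sm = second_moment_shift[OF mean, of t]
  have "2 * J * (\<integral>x. gain J (t + x) \<partial>\<mu>) + (\<integral>x. (soft_clip J (t + x))\<^sup>2 \<partial>\<mu>)
      = (\<integral>x. 2 * J * gain J (t + x) + (soft_clip J (t + x))\<^sup>2 \<partial>\<mu>)"
    using integrable_gain[of t] integrable_clip_square[of t] by simp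
  also have "\<dots> \<le> (\<integral>x. (t + x)\<^sup>2 + (?i + 8 / r) + 16 / r * x\<^sup>2 \<partial>\<mu>)"
  proof (rule integral_mono)
    fix x
    define e where "e = exp (- max 0 (J - \<bar>t + x\<bar>))"
    have e1: "e \<le> 1" by (simp add: e_def)
    have "4 * e \<le> ?i + 8 / r + 16 / r * x\<^sup>2"
    proof (cases "J - r \<le> \<bar>t\<bar>")
      case True
      have "0 \<le> 8 / r + 16 / r * x\<^sup>2" using r by simp
      then show ?thesis using e1 unfolding if_P[OF True] by linarith
    next
      case False
      show ?thesis
      proof (cases "r / 2 \<le> \<bar>x\<bar>")
        case True
        have "r * r \<le> 4 * x\<^sup>2"
          using power_mono[OF True, of 2] r by (simp add: power2_eq_square)
        moreover have "r * 1 \<le> r * r" using r by (intro mult_left_mono) auto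
        ultimately have "r \<le> 4 * x\<^sup>2" by linarith
        then have "4 \<le> 16 / r * x\<^sup>2" using r by (simp add: field_simps)
        moreover have "0 \<le> 8 / r" using r by simp
        ultimately show ?thesis using e1 unfolding if_not_P[OF False] by linarith
      next
        case x: False
        have "e \<le> exp (- (r / 2))"
          using False x unfolding e_def by simp
        also have "\<dots> \<le> 2 / r" using mult_exp_neg_le[of "r / 2"] r by (simp add: field_simps)
        finally have "4 * e \<le> 8 / r" by simp
        moreover have "0 \<le> 16 / r * x\<^sup>2" using r by simp
        ultimately show ?thesis unfolding if_not_P[OF False] by linarith
      qed
    qed
    then show "2 * J * gain J (t + x) + (soft_clip J (t + x))\<^sup>2 \<le> (t + x)\<^sup>2 + (?i + 8 / r) + 16 / r * x\<^sup>2"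
      using gain_upper[OF J_pos, of "t + x"] unfolding e_def by linarith
  qed (use integrable_gain[of t] integrable_clip_square[of t] sm square_integrable in auto)
  also have "\<dots> = t\<^sup>2 + (\<integral>x. x\<^sup>2 \<partial>\<mu>) + ?i + (8 + 16 * (\<integral>x. x\<^sup>2 \<partial>\<mu>)) / r"
    using sm square_integrable by (simp add: prob_space add_divide_distrib)
  finally show ?thesis .
qed

text \<open>Integrate \<open>gain_lower\<close>; the overshoot never exceeds the field. Away from
  the walls an overshoot needs a field of size at least \<open>r\<close>, where 1 + 2 x^2 \<le> 3
  x^2 and x^2 is at most \<open>r powr (2 - q) * \<bar>x\<bar> powr q\<close>.\<close>

lemma square_drift_lower:
  assumes mean: "(\<integral>x. x \<partial>\<mu>) = 0" and r: "1 \<le> r" and t: "\<bar>t\<bar> \<le> J"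
    and q: "2 \<le> q" "integrable \<mu> (\<lambda>x. \<bar>x\<bar> powr q)"
  shows "2 * J * (\<integral>x. gain J (t + x) \<partial>\<mu>) + (\<integral>x. (soft_clip J (t + x))\<^sup>2 \<partial>\<mu>)
    \<ge> t\<^sup>2 + (\<integral>x. x\<^sup>2 \<partial>\<mu>) - (if J - r \<le> \<bar>t\<bar> then 1 + 2 * (\<integral>x. x\<^sup>2 \<partial>\<mu>) else 0)
      - 3 * (\<integral>x. \<bar>x\<bar> powr q \<partial>\<mu>) * r powr (2 - q)"
proof -
  let ?i = "\<lambda>x. if J - r \<le> \<bar>t\<bar> then 1 + 2 * x\<^sup>2 else (0::real)"
  note sm = second_moment_shift[OF mean, of t]
  have int_i: "integrable \<mu> ?i" using square_integrable by (cases "J - r \<le> \<bar>t\<bar>") simp_all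
  have "t\<^sup>2 + (\<integral>x. x\<^sup>2 \<partial>\<mu>) - (if J - r \<le> \<bar>t\<bar> then 1 + 2 * (\<integral>x. x\<^sup>2 \<partial>\<mu>) else 0)
      - 3 * (\<integral>x. \<bar>x\<bar> powr q \<partial>\<mu>) * r powr (2 - q)
    = (\<integral>x. (t + x)\<^sup>2 \<partial>\<mu>) - (\<integral>x. ?i x \<partial>\<mu>) - (\<integral>x. 3 * r powr (2 - q) * \<bar>x\<bar> powr q \<partial>\<mu>)"
    using square_integrable by (simp add: sm(2) prob_space)
  also have "\<dots> = (\<integral>x. (t + x)\<^sup>2 - ?i x - 3 * r powr (2 - q) * \<bar>x\<bar> powr q \<partial>\<mu>)"
    using int_i sm(1) q(2) by simp
  also have "\<dots> \<le> (\<integral>x. 2 * J * gain J (t + x) + (soft_clip J (t + x))\<^sup>2 \<partial>\<mu>)"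
  proof (rule integral_mono)
    fix x
    have "(if \<bar>t + x\<bar> \<le> J then 0 else 2 * (\<bar>t + x\<bar> - J)\<^sup>2 + 1) \<le> ?i x + 3 * r powr (2 - q) * \<bar>x\<bar> powr q"
    proof (cases "\<bar>t + x\<bar> \<le> J")
      case True
      then show ?thesis by simp
    next
      case False
      have "(\<bar>t + x\<bar> - J)\<^sup>2 \<le> \<bar>x\<bar>\<^sup>2"
        using False t by (intro power_mono) auto
      then have 1: "2 * (\<bar>t + x\<bar> - J)\<^sup>2 + 1 \<le> 1 + 2 * x\<^sup>2" by simp
      show ?thesis
      proof (cases "J - r \<le> \<bar>t\<bar>")
        case True
        have "0 \<le> 3 * r powr (2 - q) * \<bar>x\<bar> powr q" by simp
        then show ?thesis using 1 unfolding if_P[OF True] if_not_P[OF False] by linarith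
      next
        case t': False
        then have x: "r \<le> \<bar>x\<bar>" using False by linarith
        have "1 \<le> x\<^sup>2" using power_mono[of 1 "\<bar>x\<bar>" 2] x r by simp
        then have "1 + 2 * x\<^sup>2 \<le> 3 * \<bar>x\<bar> powr 2"
          using x r by (simp add: powr_numeral)
        also have "\<bar>x\<bar> powr 2 = \<bar>x\<bar> powr (2 - q) * \<bar>x\<bar> powr q"
          by (simp flip: powr_add)
        also have "\<dots> \<le> r powr (2 - q) * \<bar>x\<bar> powr q"
          using x r q(1) by (intro mult_right_mono powr_mono2') auto
        finally show ?thesis using 1 unfolding if_not_P[OF t'] if_not_P[OF False] by simp
      qed
    qed
    then show "(t + x)\<^sup>2 - ?i x - 3 * r powr (2 - q) * \<bar>x\<bar> powr q
        \<le> 2 * J * gain J (t + x) + (soft_clip J (t + x))\<^sup>2"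
      using gain_lower[OF J_pos, of "t + x"] by linarith
  qed (use integrable_gain[of t] integrable_clip_square[of t] sm int_i q(2) in auto)
  also have "\<dots> = 2 * J * (\<integral>x. gain J (t + x) \<partial>\<mu>) + (\<integral>x. (soft_clip J (t + x))\<^sup>2 \<partial>\<mu>)"
    using integrable_gain[of t] integrable_clip_square[of t] by simp
  finally show ?thesis .
qed

text \<open>The test function is t^2 plus a multiple of the barrier. The multiples
  \<open>- (4 / c)\<close> and \<open>(1 + 2 v) / c\<close>, with v the second moment, are chosen so
  that the barrier drift exactly cancels the near-wall error of the square; the clipping loss shifts
  the coefficient of the free energy by a multiple of \<open>r\<close>.\<close>

lemma free_energy_bounds:
  assumes mean: "(\<integral>x. x \<partial>\<mu>) = 0" and r: "1 \<le> r"
    and q: "2 \<le> q" "integrable \<mu> (\<lambda>x. \<bar>x\<bar> powr q)"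
    and c: "0 < c" "c \<le> (\<integral>x. (if \<bar>x\<bar> \<le> r then x\<^sup>2 else 0) \<partial>\<mu>) / 10"
  shows "(2 * J - 2 * (4 / c) * r) * free_energy \<mu> J
      \<le> (\<integral>x. x\<^sup>2 \<partial>\<mu>) + (8 + 16 * (\<integral>x. x\<^sup>2 \<partial>\<mu>)) / r"
    and "(2 * J + 2 * ((1 + 2 * (\<integral>x. x\<^sup>2 \<partial>\<mu>)) / c) * r) * free_energy \<mu> J
      \<ge> (\<integral>x. x\<^sup>2 \<partial>\<mu>) - 3 * (\<integral>x. \<bar>x\<bar> powr q \<partial>\<mu>) * r powr (2 - q)"
proof -
  obtain U F where U: "\<And>s t. \<bar>U s - U t\<bar> \<le> exp (4 * J) * \<bar>s - t\<bar>" "\<And>t. bellman U t = F + U t"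
    using poisson_equation by blast
  have F: "free_energy \<mu> J = F" by (rule free_energy_eq[OF U])
  have cont: "continuous_on UNIV U" by (rule lipschitz_continuous[OF U(1)])
  have r0: "0 < r" using r by simp
  have W: "continuous_on UNIV (\<lambda>t. t\<^sup>2 + b * barrier J r t)" for b
    by (intro continuous_intros continuous_on_barrier)
  have intW: "(\<integral>x. (soft_clip J (t + x))\<^sup>2 + b * barrier J r (soft_clip J (t + x)) \<partial>\<mu>)
      = (\<integral>x. (soft_clip J (t + x))\<^sup>2 \<partial>\<mu>) + b * (\<integral>x. barrier J r (soft_clip J (t + x)) \<partial>\<mu>)" for t b
    using integrable_clip_square[of t] integrable_clip[OF continuous_on_barrier, of J r t] by simp
  show "(2 * J - 2 * (4 / c) * r) * free_energy \<mu> J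
      \<le> (\<integral>x. x\<^sup>2 \<partial>\<mu>) + (8 + 16 * (\<integral>x. x\<^sup>2 \<partial>\<mu>)) / r"
    unfolding F
  proof (rule comparison_le[OF cont U(2) W])
    fix t assume "t \<in> {- J .. J}"
    then have t: "\<bar>t\<bar> \<le> J" by auto
    let ?G = "\<integral>x. gain J (t + x) \<partial>\<mu>"
    have "(4 / c) * (barrier J r t + (if J - r \<le> \<bar>t\<bar> then c else 0) - 2 * r * ?G)
        \<le> (4 / c) * (\<integral>x. barrier J r (soft_clip J (t + x)) \<partial>\<mu>)"
      using c(1) by (intro mult_left_mono barrier_drift[OF mean r0 t c(2)]) auto
    moreover have "(4 / c) * (barrier J r t + (if J - r \<le> \<bar>t\<bar> then c else 0) - 2 * r * ?G)
      = (4 / c) * barrier J r t + (if J - r \<le> \<bar>t\<bar> then 4 else 0) - 2 * (4 / c) * r * ?G"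
      using c(1) by (auto simp: algebra_simps)
    ultimately show "(2 * J - 2 * (4 / c) * r) * ?G
        + (\<integral>x. (soft_clip J (t + x))\<^sup>2 + (- (4 / c)) * barrier J r (soft_clip J (t + x)) \<partial>\<mu>)
      \<le> ((\<integral>x. x\<^sup>2 \<partial>\<mu>) + (8 + 16 * (\<integral>x. x\<^sup>2 \<partial>\<mu>)) / r) + (t\<^sup>2 + (- (4 / c)) * barrier J r t)"
      unfolding intW using square_drift_upper[OF mean r t] by (simp add: left_diff_distrib)
  qed
  let ?b = "(1 + 2 * (\<integral>x. x\<^sup>2 \<partial>\<mu>)) / c"
  have b: "0 \<le> ?b" using c(1) by simp
  show "(2 * J + 2 * ?b * r) * free_energy \<mu> J
      \<ge> (\<integral>x. x\<^sup>2 \<partial>\<mu>) - 3 * (\<integral>x. \<bar>x\<bar> powr q \<partial>\<mu>) * r powr (2 - q)"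
    unfolding F
  proof (rule comparison_ge[OF cont U(2) W])
    fix t assume "t \<in> {- J .. J}"
    then have t: "\<bar>t\<bar> \<le> J" by auto
    let ?G = "\<integral>x. gain J (t + x) \<partial>\<mu>"
    have "?b * (barrier J r t + (if J - r \<le> \<bar>t\<bar> then c else 0) - 2 * r * ?G)
        \<le> ?b * (\<integral>x. barrier J r (soft_clip J (t + x)) \<partial>\<mu>)"
      using b by (intro mult_left_mono barrier_drift[OF mean r0 t c(2)]) auto
    moreover have "?b * (barrier J r t + (if J - r \<le> \<bar>t\<bar> then c else 0) - 2 * r * ?G)
      = ?b * barrier J r t + (if J - r \<le> \<bar>t\<bar> then 1 + 2 * (\<integral>x. x\<^sup>2 \<partial>\<mu>) else 0) - 2 * ?b * r * ?G"
      using c(1) by (auto simp: right_diff_distrib distrib_left)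
    ultimately show "(2 * J + 2 * ?b * r) * ?G
        + (\<integral>x. (soft_clip J (t + x))\<^sup>2 + ?b * barrier J r (soft_clip J (t + x)) \<partial>\<mu>)
      \<ge> ((\<integral>x. x\<^sup>2 \<partial>\<mu>) - 3 * (\<integral>x. \<bar>x\<bar> powr q \<partial>\<mu>) * r powr (2 - q)) + (t\<^sup>2 + ?b * barrier J r t)"
      unfolding intW using square_drift_lower[OF mean r t q] by (simp only: distrib_right) linarith
  qed
qed

end

section \<open>Asymptotics\<close>

lemma truncated_second_moment_tendsto:
  assumes [measurable_cong]: "sets \<mu> = sets borel" and int: "integrable \<mu> (\<lambda>x::real. x\<^sup>2)"
  shows "((\<lambda>r::real. \<integral>x. (if \<bar>x\<bar> \<le> r then x\<^sup>2 else 0) \<partial>\<mu>) \<longlongrightarrow> (\<integral>x. x\<^sup>2 \<partial>\<mu>)) at_top"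
proof (rule integral_dominated_convergence_at_top)
  show "\<And>r. (\<lambda>x. if \<bar>x\<bar> \<le> r then x\<^sup>2 else 0) \<in> borel_measurable \<mu>" by measurable
  show "(\<lambda>x. x\<^sup>2) \<in> borel_measurable \<mu>" by measurable
  show "integrable \<mu> (\<lambda>x::real. x\<^sup>2)" by fact
  show "AE x in \<mu>. ((\<lambda>r. if \<bar>x\<bar> \<le> r then x\<^sup>2 else 0) \<longlongrightarrow> x\<^sup>2) at_top"
  proof (rule AE_I2)
    fix x :: real
    have "\<forall>\<^sub>F r in at_top. (if \<bar>x\<bar> \<le> r then x\<^sup>2 else 0) = x\<^sup>2"
      using eventually_ge_at_top[of "\<bar>x\<bar>"] by eventually_elim simp
    then show "((\<lambda>r. if \<bar>x\<bar> \<le> r then x\<^sup>2 else 0) \<longlongrightarrow> x\<^sup>2) at_top"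
      by (rule tendsto_eventually)
  qed
  show "\<forall>\<^sub>F r in at_top. AE x in \<mu>. norm (if \<bar>x\<bar> \<le> r then x\<^sup>2 else 0) \<le> x\<^sup>2"
    by (intro always_eventually allI AE_I2) simp
qed

lemma second_moment_pos:
  assumes "prob_space \<mu>" "sets \<mu> = sets borel" "integrable \<mu> (\<lambda>x::real. x\<^sup>2)" "\<mu> \<noteq> return borel 0"
  shows "0 < (\<integral>x. x\<^sup>2 \<partial>\<mu>)"
proof (rule ccontr)
  interpret prob_space \<mu> by fact
  note [measurable_cong] = assms(2)
  assume "\<not> ?thesis"
  moreover have "0 \<le> (\<integral>x. x\<^sup>2 \<partial>\<mu>)" by simp
  ultimately have "(\<integral>x. x\<^sup>2 \<partial>\<mu>) = 0" by linarith
  then have ae: "AE x in \<mu>. x = 0"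
    using integral_nonneg_eq_0_iff_AE[OF assms(3)] by simp
  have "\<mu> = distr \<mu> borel (\<lambda>x. x)"
    using distr_id2[of borel \<mu>] assms(2) by simp
  also have "\<dots> = distr \<mu> borel (\<lambda>x. 0)"
    using ae by (intro distr_cong_AE) auto
  also have "\<dots> = return borel 0" by simp
  finally show False using assms(4) by simp
qed

lemma in_Lp_mono:
  assumes "prob_space \<mu>" "sets \<mu> = sets borel" "in_Lp \<mu> p" "0 \<le> q" "q \<le> p"
  shows "in_Lp \<mu> q"
proof -
  interpret prob_space \<mu> by fact
  note [measurable_cong] = assms(2)
  have "\<bar>x\<bar> powr q \<le> 1 + \<bar>x\<bar> powr p" for x :: real
  proof (cases "\<bar>x\<bar> \<le> 1")
    case True
    have "\<bar>x\<bar> powr q \<le> 1 powr q" using True assms(4) by (intro powr_mono2) auto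
    then show ?thesis by (simp add: add_increasing2)
  next
    case False
    then have "\<bar>x\<bar> powr q \<le> \<bar>x\<bar> powr p" using assms(5) by (intro powr_mono) auto
    then show ?thesis by simp
  qed
  moreover have "integrable \<mu> (\<lambda>x. 1 + \<bar>x\<bar> powr p)" using assms(3) by (simp add: in_Lp_def)
  ultimately show ?thesis unfolding in_Lp_def
    by (intro Bochner_Integration.integrable_bound[where g="\<lambda>x. \<bar>x\<bar> powr q"]) auto
qed

text \<open>For r = J^(1/q) every relative error is at most a multiple of e = r^(2 - q): r / J
  equals r^(1 - q), and 1 / r \<le> e because q \<le> 3. Finally e / J is exactly J^(- 2 (q - 1) /
  q).\<close>

theorem free_energy_asymptotics:
  fixes \<mu> :: "real measure"
  assumes \<mu>: "prob_space \<mu>" "sets \<mu> = sets borel" "integrable \<mu> (\<lambda>x. x\<^sup>2)"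
    and mean: "(\<integral>x. x \<partial>\<mu>) = 0" and nontrivial: "\<mu> \<noteq> return borel 0"
    and q: "2 \<le> q" "q \<le> 3" "in_Lp \<mu> q"
  shows "\<exists>C. 0 \<le> C \<and> (\<forall>\<^sub>F J in at_top.
    \<bar>free_energy \<mu> J - (\<integral>x. x\<^sup>2 \<partial>\<mu>) / (2 * J)\<bar> \<le> C / J powr (2 * (q - 1) / q))"
proof -
  define v where "v = (\<integral>x. x\<^sup>2 \<partial>\<mu>)"
  define m where "m = (\<integral>x. \<bar>x\<bar> powr q \<partial>\<mu>)"
  \<comment> \<open>The truncated second moment eventually exceeds v / 2, and
    \<open>free_energy_bounds\<close> allows a tenth of it.\<close>
  define c where "c = v / 20"
  define K where "K = 8 + 16 * v"
  define b where "b = (1 + 2 * v) / c"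
  define B where "B = v + K"
  \<comment> \<open>The sum of the two one-sided constants, so that one \<open>C\<close> serves both
    sides.\<close>
  define C where "C = (K + 2 * (4 / c) * B) + (3 * m + 2 * b * B)"
  have v: "0 < v" using second_moment_pos[OF \<mu> nontrivial] by (simp add: v_def)
  have pos: "0 < c" "0 \<le> K" "0 < b" "0 \<le> B" "0 \<le> m" using v by (auto simp: c_def K_def b_def B_def m_def)
  have C0: "0 \<le> C" using pos by (simp add: C_def)
  have r_top: "filterlim (\<lambda>J::real. J powr (1 / q)) at_top at_top"
    using q by real_asymp
  have "((\<lambda>r::real. (\<integral>x. (if \<bar>x\<bar> \<le> r then x\<^sup>2 else 0) \<partial>\<mu>)) \<longlongrightarrow> v) at_top"
    unfolding v_def by (rule truncated_second_moment_tendsto[OF \<mu>(2,3)])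
  then have "\<forall>\<^sub>F r in at_top. v / 2 < (\<integral>x. (if \<bar>x\<bar> \<le> r then x\<^sup>2 else 0) \<partial>\<mu>)"
    using v by (intro order_tendstoD) auto
  then have ev_c: "\<forall>\<^sub>F J in at_top. v / 2 < (\<integral>x. (if \<bar>x\<bar> \<le> J powr (1 / q) then x\<^sup>2 else 0) \<partial>\<mu>)"
    using r_top by (rule eventually_compose_filterlim)
  have "((\<lambda>J::real. J powr (1 / q - 1)) \<longlongrightarrow> 0) at_top"
    using q by (intro tendsto_neg_powr filterlim_ident) (auto simp: field_simps)
  \<comment> \<open>The threshold \<open>c / 8\<close> makes \<open>2 * (4 / c) * r\<close> at most
    \<open>J\<close>, which keeps the coefficient in the upper bound at least
    \<open>J\<close>.\<close>
  then have ev_small: "\<forall>\<^sub>F J in at_top. J powr (1 / q - 1) < c / 8"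
    using pos by (intro order_tendstoD) auto
  have "\<forall>\<^sub>F J in at_top.
    \<bar>free_energy \<mu> J - v / (2 * J)\<bar> \<le> C / J powr (2 * (q - 1) / q)"
    using ev_c ev_small eventually_ge_at_top[of 1]
  proof eventually_elim
    case (elim J)
    interpret ising_chain \<mu> J
      using \<mu> elim by (intro ising_chain.intro ising_chain_axioms.intro) auto
    define r where "r = J powr (1 / q)"
    define e where "e = r powr (2 - q)"
    define F where "F = free_energy \<mu> J"
    have J: "1 \<le> J" "0 < J" using elim by auto
    have r: "1 \<le> r" unfolding r_def using J q by (intro ge_one_powr_ge_zero) auto
    have e_eq: "e = J powr ((2 - q) / q)" by (simp add: e_def r_def powr_powr)
    have rJ_eq: "r / J = J powr (1 / q - 1)" using J by (simp add: r_def powr_diff)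
    have rJ: "r / J \<le> e"
      unfolding rJ_eq e_eq using J q by (intro powr_mono) (auto simp: field_simps)
    have r_inv: "1 / r \<le> e"
      using r q powr_mono[of "- 1" "2 - q" r] by (simp add: e_def powr_minus_divide)
    have e1: "e \<le> 1" unfolding e_def using r q powr_mono[of "2 - q" 0 r] by simp
    have e0: "0 \<le> e" by (simp add: e_def)
    have small: "4 / c * r \<le> J / 2"
    proof -
      have "r < c / 8 * J" using elim(2) J unfolding rJ_eq[symmetric] by (simp add: field_simps)
      then have "4 / c * r \<le> 4 / c * (c / 8 * J)" using pos by (intro mult_left_mono) auto
      then show ?thesis using pos by simp
    qed
    have c_le: "c \<le> (\<integral>x. (if \<bar>x\<bar> \<le> r then x\<^sup>2 else 0) \<partial>\<mu>) / 10"
      using elim(1) by (simp add: c_def r_def)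
    note bounds = free_energy_bounds[OF mean r q(1) q(3)[unfolded in_Lp_def] pos(1) c_le,
        folded v_def m_def, folded K_def b_def e_def F_def]
    have "K / r \<le> K * e" using mult_left_mono[OF r_inv pos(2)] by simp
    with bounds(1) have up: "(2 * J - 2 * (4 / c) * r) * F \<le> v + K * e" by linarith
    \<comment> \<open>A crude upper bound of order 1 / J. Lowering the coefficient to
      \<open>J\<close> requires nonnegative \<open>F\<close>; for negative \<open>F\<close> the
      bound is immediate.\<close>
    have FB: "J * F \<le> B"
    proof (cases "0 \<le> F")
      case True
      have "J * F \<le> (2 * J - 2 * (4 / c) * r) * F"
        using small True by (intro mult_right_mono) auto
      also have "\<dots> \<le> v + K * e" by (rule up)
      also have "\<dots> \<le> B" using mult_left_mono[OF e1 pos(2)] by (simp add: B_def)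
      finally show ?thesis .
    next
      case False
      then have "J * F \<le> 0" using J by (intro mult_nonneg_nonpos) auto
      then show ?thesis using pos by linarith
    qed
    \<comment> \<open>The shift of the coefficient thus becomes an error of order \<open>e\<close>;
      in both directions only an upper bound on \<open>r * F\<close> enters.\<close>
    have rF: "r * F \<le> e * B"
    proof -
      have "r * F = r / J * (J * F)" using J by simp
      also have "\<dots> \<le> r / J * B" using FB r J by (intro mult_left_mono) auto
      also have "\<dots> \<le> e * B" using rJ pos by (intro mult_right_mono) auto
      finally show ?thesis .
    qed
    have "2 * J * F \<le> v + K * e + 2 * (4 / c) * (r * F)"
      using up by (simp add: algebra_simps)
    also have "\<dots> \<le> v + K * e + 2 * (4 / c) * (e * B)"
      using rF pos by (intro add_left_mono mult_left_mono) auto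
    finally have "2 * J * F \<le> v + (K + 2 * (4 / c) * B) * e" by (simp add: algebra_simps)
    also have "\<dots> \<le> v + C * e"
      using e0 pos by (intro add_left_mono mult_right_mono) (auto simp: C_def)
    finally have upper: "2 * J * F - v \<le> C * e" by simp
    have "v - 3 * m * e - 2 * b * (r * F) \<le> 2 * J * F"
      using bounds(2) by (simp add: algebra_simps)
    moreover have "2 * b * (r * F) \<le> 2 * b * (e * B)"
      using rF pos by (intro mult_left_mono) auto
    ultimately have "v - (3 * m + 2 * b * B) * e \<le> 2 * J * F" by (simp add: algebra_simps)
    moreover have "(3 * m + 2 * b * B) * e \<le> C * e"
      using e0 pos by (intro mult_right_mono) (auto simp: C_def)
    ultimately have lower: "- (C * e) \<le> 2 * J * F - v" by linarith
    have "\<bar>F - v / (2 * J)\<bar> = \<bar>2 * J * F - v\<bar> / (2 * J)"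
      using J by (simp add: field_simps abs_divide flip: abs_mult)
    also have "\<dots> \<le> C * e / (2 * J)"
      using upper lower J by (intro divide_right_mono) auto
    also have "\<dots> \<le> C * (e / J)"
      using J C0 e0 by (simp add: field_simps)
    also have "e / J = J powr ((2 - q) / q - 1)"
      using J by (simp add: e_eq powr_diff)
    also have "(2 - q) / q - 1 = - (2 * (q - 1) / q)"
      using q by (simp add: field_simps)
    finally show ?case
      unfolding F_def powr_minus_divide by (simp only: times_divide_eq_right mult_1_right)
  qed
  then show ?thesis using C0 unfolding v_def by blast
qed

section \<open>Deduction of the stated rates\<close>

lemma powr_smallo_inverse:
  fixes a :: real
  assumes "1 < a" shows "(\<lambda>J::real. 1 / J powr a) \<in> o[at_top](\<lambda>J. 1 / J)"
  using assms by real_asymp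

lemma ln_powr_smallo_inverse:
  fixes a s :: real
  assumes "1 < a" "0 < s" shows "(\<lambda>J::real. (ln J) powr s / J powr a) \<in> o[at_top](\<lambda>J. 1 / J)"
  using assms by real_asymp

theorem theorem3:
  fixes \<mu> :: "real measure" and \<theta> :: real
  assumes "prob_space \<mu>" and "sets \<mu> = sets borel"
    and "integrable \<mu> (\<lambda>x. x\<^sup>2)"
    and "prob_space.expectation \<mu> (\<lambda>x. x) = 0"
    and "\<mu> \<noteq> return borel 0"
    and "\<theta>\<^sup>2 = prob_space.variance \<mu> (\<lambda>x. x)"
  shows
    "(\<forall>p\<ge>3. in_Lp \<mu> p \<longrightarrow>
        ge_upto_O (free_energy \<mu>) (\<lambda>J. \<theta>\<^sup>2 / (2 * J))
          (\<lambda>J. (ln J) powr (1/3) / J powr (4/3)) \<and>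
        le_upto_O (free_energy \<mu>) (\<lambda>J. \<theta>\<^sup>2 / (2 * J))
          (\<lambda>J. 1 / J powr (4 * p / (3 * p + 2)))) \<and>
     (\<forall>p. 2 \<le> p \<and> p < 3 \<and> in_Lp \<mu> p \<longrightarrow>
        ge_upto_O (free_energy \<mu>) (\<lambda>J. \<theta>\<^sup>2 / (2 * J))
          (\<lambda>J. (ln J) powr ((p - 1) / (2 * p)) / J powr (2 * (p - 1) / p)) \<and>
        le_upto_O (free_energy \<mu>) (\<lambda>J. \<theta>\<^sup>2 / (2 * J))
          (\<lambda>J. 1 / J powr (2 * p * (p - 1) / (p\<^sup>2 + p - 1)))) \<and>
     (\<forall>p. p > (3 + sqrt 5) / 2 \<and> in_Lp \<mu> p \<longrightarrow>
        (p \<ge> 3 \<longrightarrow>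
          (\<lambda>J::real. (ln J) powr (1/3) / J powr (4/3)) \<in> o[at_top](\<lambda>J. 1 / J) \<and>
          (\<lambda>J::real. 1 / J powr (4 * p / (3 * p + 2))) \<in> o[at_top](\<lambda>J. 1 / J)) \<and>
        (p < 3 \<longrightarrow>
          (\<lambda>J::real. (ln J) powr ((p - 1) / (2 * p)) / J powr (2 * (p - 1) / p))
             \<in> o[at_top](\<lambda>J. 1 / J) \<and>
          (\<lambda>J::real. 1 / J powr (2 * p * (p - 1) / (p\<^sup>2 + p - 1)))
             \<in> o[at_top](\<lambda>J. 1 / J)) \<and>
        asymp_equiv (free_energy \<mu>) at_top (\<lambda>J. \<theta>\<^sup>2 / (2 * J)))"
proof -
  let ?f = "\<lambda>J. \<theta>\<^sup>2 / (2 * J)"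
  have \<theta>: "\<theta>\<^sup>2 = (\<integral>x. x\<^sup>2 \<partial>\<mu>)" using assms(4,6) by simp
  have \<theta>_pos: "0 < \<theta>\<^sup>2"
    unfolding \<theta> by (rule second_moment_pos[OF assms(1,2,3,5)])
  note asym = free_energy_asymptotics[OF assms(1-5), folded \<theta>]
  \<comment> \<open>The logarithmic factor is at least 1 once \<open>J \<ge> exp 1\<close>, so the
    logarithm-free bound implies this one.\<close>
  have ge: "ge_upto_O (free_energy \<mu>) ?f (\<lambda>J. (ln J) powr s / J powr (2 * (q - 1) / q))"
    if q: "2 \<le> q" "q \<le> 3" "in_Lp \<mu> q" and s: "0 \<le> s" for q s
  proof -
    obtain C where C: "0 \<le> C" "\<forall>\<^sub>F J in at_top. \<bar>free_energy \<mu> J - ?f J\<bar> \<le> C / J powr (2 * (q - 1) / q)"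
      using asym[OF q] by blast
    have "\<forall>\<^sub>F J in at_top. free_energy \<mu> J \<ge> ?f J - C * ((ln J) powr s / J powr (2 * (q - 1) / q))"
      using C(2) eventually_ge_at_top[of "exp 1"]
    proof eventually_elim
      case (elim J)
      then have "1 \<le> ln J" using ln_mono[of "exp 1" J] by (simp add: order_trans[OF _ elim(2)])
      then have "1 \<le> ln J powr s" using s by (intro ge_one_powr_ge_zero) auto
      then have "C / J powr (2 * (q - 1) / q) * 1 \<le> C / J powr (2 * (q - 1) / q) * ln J powr s"
        using C(1) by (intro mult_left_mono) auto
      then show ?case using elim(1) by (simp add: abs_le_iff algebra_simps)
    qed
    then show ?thesis unfolding ge_upto_O_def by blast
  qed
  have le: "le_upto_O (free_energy \<mu>) ?f (\<lambda>J. 1 / J powr a)"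
    if q: "2 \<le> q" "q \<le> 3" "in_Lp \<mu> q" and a: "a \<le> 2 * (q - 1) / q" for q a
  proof -
    obtain C where C: "0 \<le> C" "\<forall>\<^sub>F J in at_top. \<bar>free_energy \<mu> J - ?f J\<bar> \<le> C / J powr (2 * (q - 1) / q)"
      using asym[OF q] by blast
    have "\<forall>\<^sub>F J in at_top. free_energy \<mu> J \<le> ?f J + C * (1 / J powr a)"
      using C(2) eventually_ge_at_top[of 1]
    proof eventually_elim
      case (elim J)
      have "C / J powr (2 * (q - 1) / q) \<le> C / J powr a"
        using elim(2) C(1) a by (intro divide_left_mono powr_mono) auto
      then show ?case using elim(1) by (simp add: abs_le_iff algebra_simps)
    qed
    then show ?thesis unfolding le_upto_O_def by blast
  qed
  \<comment> \<open>For \<open>q > 2\<close> the exponent \<open>2 * (q - 1) / q\<close> exceeds 1,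
    so the error is negligible against the main term.\<close>
  have equiv: "free_energy \<mu> \<sim>[at_top] ?f"
    if q: "2 < q" "q \<le> 3" "in_Lp \<mu> q" for q
  proof -
    obtain C where C: "0 \<le> C" "\<forall>\<^sub>F J in at_top. \<bar>free_energy \<mu> J - ?f J\<bar> \<le> C / J powr (2 * (q - 1) / q)"
      using asym[of q] q by auto
    have "(\<lambda>J. free_energy \<mu> J - ?f J) \<in> O[at_top](\<lambda>J. 1 / J powr (2 * (q - 1) / q))"
      using C(2) by (intro bigoI[of _ C]) simp
    also have "(\<lambda>J::real. 1 / J powr (2 * (q - 1) / q)) \<in> o[at_top](\<lambda>J. 1 / J)"
      using q by (intro powr_smallo_inverse) (simp add: field_simps)
    also have "(\<lambda>J::real. 1 / J) \<in> O[at_top](?f)"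
      using \<theta>_pos by (intro bigoI[of _ "2 / \<theta>\<^sup>2"]) (auto simp: field_simps intro!: always_eventually)
    finally show ?thesis by (simp add: asymp_equiv_altdef)
  qed
  have three: "in_Lp \<mu> 3" if "3 \<le> p" "in_Lp \<mu> p" for p
    using in_Lp_mono[OF assms(1,2) that(2)] that(1) by simp
  have sqrt5: "2 < sqrt 5" by (simp add: real_less_rsqrt)
  show ?thesis
  proof (intro conjI allI impI; (elim conjE)?)
    fix p :: real assume p: "3 \<le> p" "in_Lp \<mu> p"
    \<comment> \<open>At \<open>q = 3\<close> the exponent is 4/3, which also dominates
      \<open>4 * p / (3 * p + 2)\<close>.\<close>
    show "ge_upto_O (free_energy \<mu>) ?f (\<lambda>J. (ln J) powr (1/3) / J powr (4/3))"
      using ge[of 3 "1/3"] three[OF p] by simp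
    show "le_upto_O (free_energy \<mu>) ?f (\<lambda>J. 1 / J powr (4 * p / (3 * p + 2)))"
      using p three[OF p] by (intro le[of 3]) (auto simp: field_simps)
  next
    fix p :: real assume p: "2 \<le> p" "p < 3" "in_Lp \<mu> p"
    show "ge_upto_O (free_energy \<mu>) ?f (\<lambda>J. (ln J) powr ((p - 1) / (2 * p)) / J powr (2 * (p - 1) / p))"
      using p by (intro ge) auto
    \<comment> \<open>The two sides differ by 2 (p - 1)^2.\<close>
    have "p * (2 * p * (p - 1)) \<le> 2 * (p - 1) * (p\<^sup>2 + p - 1)"
      using zero_le_power2[of "p - 1"] by (simp add: power2_eq_square algebra_simps)
    moreover have "0 < p\<^sup>2 + p - 1" using p zero_le_power2[of p] by linarith
    ultimately have "2 * p * (p - 1) / (p\<^sup>2 + p - 1) \<le> 2 * (p - 1) / p"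
      using p by (simp add: divide_le_eq pos_le_divide_eq mult.commute)
    then show "le_upto_O (free_energy \<mu>) ?f (\<lambda>J. 1 / J powr (2 * p * (p - 1) / (p\<^sup>2 + p - 1)))"
      using p by (intro le[of p]) auto
  next
    fix p :: real assume p: "(3 + sqrt 5) / 2 < p" "in_Lp \<mu> p"
    have p2: "2 < p" using p sqrt5 by simp
    show "free_energy \<mu> \<sim>[at_top] ?f"
      using equiv[of "min p 3"] p p2 three[of p] by (cases "p \<le> 3") (auto simp: min_def)
    {
      assume p3: "3 \<le> p"
      show "(\<lambda>J::real. (ln J) powr (1/3) / J powr (4/3)) \<in> o[at_top](\<lambda>J. 1 / J)"
        by (intro ln_powr_smallo_inverse) auto
      show "(\<lambda>J::real. 1 / J powr (4 * p / (3 * p + 2))) \<in> o[at_top](\<lambda>J. 1 / J)"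
        using p3 by (intro powr_smallo_inverse) (simp add: field_simps)
    }
    {
      assume p3: "p < 3"
      show "(\<lambda>J::real. (ln J) powr ((p - 1) / (2 * p)) / J powr (2 * (p - 1) / p)) \<in> o[at_top](\<lambda>J. 1 / J)"
        using p2 by (intro ln_powr_smallo_inverse) (auto simp: field_simps)
      \<comment> \<open>The numbers (3 + sqrt 5) / 2 and (3 - sqrt 5) / 2 are the roots of p^2 - 3 p
        + 1, whose positivity says that the exponent below exceeds 1.\<close>
      have "0 < (p - (3 + sqrt 5) / 2) * (p - (3 - sqrt 5) / 2)"
        using p sqrt5 by (intro mult_pos_pos) auto
      also have "\<dots> = p\<^sup>2 - 3 * p + 1"
        by (simp add: power2_eq_square field_simps)
      finally have "p\<^sup>2 + p - 1 < 2 * p * (p - 1)" by (simp add: power2_eq_square algebra_simps)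
      moreover have "0 < p\<^sup>2 + p - 1" using p2 zero_le_power2[of p] by linarith
      ultimately show "(\<lambda>J::real. 1 / J powr (2 * p * (p - 1) / (p\<^sup>2 + p - 1))) \<in> o[at_top](\<lambda>J. 1 / J)"
        by (intro powr_smallo_inverse) simp
    }
  qed
qed

end
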